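(* Let $A$ be a bounded band operator on $\ell^2(\mathbb{Z})$, in its block-tridiagonal representation on $\ell^2(\mathbb{Z},\mathbb{C}^d)$ with sub- and superdiagonals $\alpha,\gamma$, and for $n\in\mathbb{N}$ let $$\varepsilon_n = 2(\|\alpha\|_\infty+\|\gamma\|_\infty)\sin\frac{\pi}{2(n+1)}.$$ Then for all $\varepsilon>0$ and $n\in\mathbb{N}$, $$\bigcup_{k\in\mathbb{Z}}\mathrm{spec}_{\varepsilon}(AP_{n,k},A^*P_{n,k})\ \subseteq\ \mathrm{spec}_\varepsilon A\ \subseteq\ \bigcup_{k\in\mathbb{Z}}\mathrm{spec}_{\varepsilon+\varepsilon_n}(AP_{n,k},A^*P_{n,k}).$$
   Context: Band operator: a bounded linear operator on $\ell^2(\mathbb{Z})$ (complex sequences, Euclidean norm) given by a bi-infinite matrix $(A_{i,j})$ with finite bandwidth $b$, where $b$ is the largest $|i-j|$ over all positions with $A_{i,j}\neq 0$; each diagonal is a bounded sequence. Block-tridiagonal representation: if $b\le 1$ put $d=1$; if $b>1$ put $d=b+1$ and group the indices in $\mathbb{Z}$ into consecutive blocks of length $d$, identifying $\ell^2(\mathbb{Z})$ with $\ell^2(\mathbb{Z},\mathbb{C}^d)$. Then $A$ is a tridiagonal matrix whose entries $A_{i,j}$ are $d\times d$ complex matrices (scalars if $d=1$). From here on, all indices, columns and supports refer to this representation. Put $\alpha_i=A_{i+1,i}$, $\gamma_i=A_{i-1,i}$, $\|\alpha\|_\infty=\sup_i\|\alpha_i\|$, $\|\gamma\|_\infty=\sup_i\|\gamma_i\|$,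 with the operator norm induced by the Euclidean norm on $\mathbb{C}^d$. $A^*$ denotes the Banach space adjoint (the transpose matrix, without complex conjugation), so $(\lambda I)^*=\lambda I$. Lower norm: $\nu(B)=\inf\{\|Bx\|:\|x\|=1\}$, the infimum being over $x$ in the domain space of $B$. Pseudospectrum: $\mathrm{spec}_\varepsilon A=\{\lambda\in\mathbb{C}:\|(A-\lambda I)^{-1}\|>1/\varepsilon\}$ for $\varepsilon>0$, with $\|B^{-1}\|:=\infty$ if $B$ is not invertible. For $n\in\mathbb{N}=\{1,2,\dots\}$ and $k\in\mathbb{Z}$, $BP_{n,k}$ denotes the restriction of $B$ to the sequences supported in $k+\{1,\dots,n\}$, i.e. the matrix formed by columns $k+1,\dots,k+n$ of $B$. For $B=A$ or $B=A^*$, $\mathrm{spec}_\varepsilon(BP_{n,k}):=\{\lambda\in\mathbb{C}:\nu((B-\lambda I)P_{n,k})<\varepsilon\}$. Finally $\mathrm{spec}_\varepsilon(AP_{n,k},A^*P_{n,k}):=\mathrm{spec}_\varepsilon(AP_{n,k})\cup\mathrm{spec}_\varepsilon(A^*P_{n,k})$. *)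

theory Defs
  imports "HOL-Analysis.Analysis"
begin

text \<open>A bi-infinite complex matrix is a function \<open>A :: int \<Rightarrow> int \<Rightarrow> complex\<close>, with row index first.
  Matrices, sequences and norms are kept in scalar coordinates; the block-tridiagonal
  representation with block length \<open>d\<close> is the identification of the scalar index \<open>i * d + r\<close>
  (\<open>0 \<le> r < d\<close>) with the \<open>r\<close>-th coordinate of the block index \<open>i\<close>. This identification of
  \<open>\<ell>\<^sup>2(\<int>)\<close> with \<open>\<ell>\<^sup>2(\<int>, \<complex>\<^sup>d)\<close> is isometric.\<close>

definition ell2 :: "(int \<Rightarrow> complex) set" where
  "ell2 = {x. (\<lambda>i. (cmod (x i))\<^sup>2) summable_on UNIV}"

definition ell2_norm :: "(int \<Rightarrow> complex) \<Rightarrow> real" where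
  "ell2_norm x = sqrt (\<Sum>\<^sub>\<infinity>i. (cmod (x i))\<^sup>2)"

text \<open>Finite bandwidth and bounded diagonals; \<open>mat_op A\<close> below is then a bounded linear operator
  on \<open>\<ell>\<^sup>2(\<int>)\<close>.\<close>

definition band_operator :: "(int \<Rightarrow> int \<Rightarrow> complex) \<Rightarrow> bool" where
  "band_operator A \<longleftrightarrow>
     (\<exists>b. \<forall>i j. A i j \<noteq> 0 \<longrightarrow> \<bar>i - j\<bar> \<le> b) \<and>
     (\<forall>k. bounded (range (\<lambda>i. A (i + k) i)))"

text \<open>On \<^typ>\<open>nat\<close> the supremum of the empty set is 0, so the zero matrix has bandwidth 0.\<close>

definition bandwidth :: "(int \<Rightarrow> int \<Rightarrow> complex) \<Rightarrow> nat" where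
  "bandwidth A = Sup {nat \<bar>i - j\<bar> |i j. A i j \<noteq> 0}"

definition block_size :: "(int \<Rightarrow> int \<Rightarrow> complex) \<Rightarrow> nat" where
  "block_size A = (if bandwidth A \<le> 1 then 1 else bandwidth A + 1)"

definition block :: "nat \<Rightarrow> (int \<Rightarrow> int \<Rightarrow> complex) \<Rightarrow> int \<Rightarrow> int \<Rightarrow> nat \<Rightarrow> nat \<Rightarrow> complex" where
  "block d A i j = (\<lambda>r s. A (i * int d + int r) (j * int d + int s))"

text \<open>The operator norm of a \<open>d \<times> d\<close> matrix induced by the Euclidean norm on \<open>\<complex>\<^sup>d\<close>.\<close>

definition block_norm :: "nat \<Rightarrow> (nat \<Rightarrow> nat \<Rightarrow> complex) \<Rightarrow> real" where
  "block_norm d M =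
     (SUP v\<in>{v. L2_set (\<lambda>s. cmod (v s)) {..<d} = 1}.
        L2_set (\<lambda>r. cmod (\<Sum>s<d. M r s * v s)) {..<d})"

definition subdiag_norm :: "(int \<Rightarrow> int \<Rightarrow> complex) \<Rightarrow> real" where
  "subdiag_norm A = (SUP i. block_norm (block_size A) (block (block_size A) A (i + 1) i))"

definition superdiag_norm :: "(int \<Rightarrow> int \<Rightarrow> complex) \<Rightarrow> real" where
  "superdiag_norm A = (SUP i. block_norm (block_size A) (block (block_size A) A (i - 1) i))"

definition eps_n :: "(int \<Rightarrow> int \<Rightarrow> complex) \<Rightarrow> nat \<Rightarrow> real" where
  "eps_n A n = 2 * (subdiag_norm A + superdiag_norm A) * sin (pi / (2 * (real n + 1)))"

text \<open>The Banach space adjoint, i.e. the transpose without complex conjugation.\<close>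

definition adj :: "(int \<Rightarrow> int \<Rightarrow> complex) \<Rightarrow> int \<Rightarrow> int \<Rightarrow> complex" where
  "adj A = (\<lambda>i j. A j i)"

definition mat_op :: "(int \<Rightarrow> int \<Rightarrow> complex) \<Rightarrow> (int \<Rightarrow> complex) \<Rightarrow> int \<Rightarrow> complex" where
  "mat_op A x = (\<lambda>i. \<Sum>\<^sub>\<infinity>j. A i j * x j)"

definition shifted_op ::
    "(int \<Rightarrow> int \<Rightarrow> complex) \<Rightarrow> complex \<Rightarrow> (int \<Rightarrow> complex) \<Rightarrow> int \<Rightarrow> complex" where
  "shifted_op A z x = (\<lambda>i. mat_op A x i - z * x i)"

text \<open>\<open>X\<close> is the domain space.\<close>

definition lower_norm ::
    "(int \<Rightarrow> complex) set \<Rightarrow> ((int \<Rightarrow> complex) \<Rightarrow> int \<Rightarrow> complex) \<Rightarrow> real" where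
  "lower_norm X B = (INF x\<in>{x \<in> X. ell2_norm x = 1}. ell2_norm (B x))"

definition op_norm :: "((int \<Rightarrow> complex) \<Rightarrow> int \<Rightarrow> complex) \<Rightarrow> ereal" where
  "op_norm B = (SUP x\<in>{x \<in> ell2. ell2_norm x = 1}. ereal (ell2_norm (B x)))"

text \<open>The norm of the inverse as an operator on \<open>\<ell>\<^sup>2(\<int>)\<close>, infinite if \<open>B\<close> is not invertible. A
  bijection whose inverse is unbounded would also be assigned \<open>\<infinity>\<close>, so the value is finite
  exactly if there is a bounded inverse.\<close>

definition inv_norm :: "((int \<Rightarrow> complex) \<Rightarrow> int \<Rightarrow> complex) \<Rightarrow> ereal" where
  "inv_norm B = (if bij_betw B ell2 ell2 then op_norm (inv_into ell2 B) else \<infinity>)"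

definition pseudospec :: "real \<Rightarrow> (int \<Rightarrow> int \<Rightarrow> complex) \<Rightarrow> complex set" where
  "pseudospec \<epsilon> A = {z. inv_norm (shifted_op A z) > ereal (1 / \<epsilon>)}"

text \<open>The sequences supported in the blocks \<open>k + 1, \<dots>, k + n\<close>; the scalar index \<open>j\<close> belongs to
  the block \<open>j div d\<close> (integer division rounds down).\<close>

definition block_supported :: "nat \<Rightarrow> nat \<Rightarrow> int \<Rightarrow> (int \<Rightarrow> complex) set" where
  "block_supported d n k = {x \<in> ell2. \<forall>j. x j \<noteq> 0 \<longrightarrow> j div int d \<in> {k + 1..k + int n}}"

definition pseudospec_cols ::
    "nat \<Rightarrow> real \<Rightarrow> (int \<Rightarrow> int \<Rightarrow> complex) \<Rightarrow> nat \<Rightarrow> int \<Rightarrow> complex set" where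
  "pseudospec_cols d \<epsilon> B n k =
     {z. lower_norm (block_supported d n k) (shifted_op B z) < \<epsilon>}"

text \<open>Both \<open>A\<close> and its adjoint are cut along the blocks of \<open>A\<close>.\<close>

definition pseudospec_cols_pair ::
    "real \<Rightarrow> (int \<Rightarrow> int \<Rightarrow> complex) \<Rightarrow> nat \<Rightarrow> int \<Rightarrow> complex set" where
  "pseudospec_cols_pair \<epsilon> A n k =
     pseudospec_cols (block_size A) \<epsilon> A n k \<union> pseudospec_cols (block_size A) \<epsilon> (adj A) n k"

end

theory Submission
  imports Defs
begin

text \<open>Both inclusions come from one description of the pseudospectrum: \<open>z\<close> lies in
  \<^term>\<open>pseudospec \<epsilon> A\<close> if and only if some \<open>x\<close> in \<open>\<ell>\<^sup>2\<close> satisfies \<open>\<parallel>(A - z) x\<parallel> < \<epsilon> \<parallel>x\<parallel>\<close> or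
  \<open>\<parallel>(A\<^sup>T - z) x\<parallel> < \<epsilon> \<parallel>x\<parallel>\<close> (\<open>pseudospec_iff\<close>). The set of \<open>z\<close> for \<open>n\<close> block columns is described
  in the same way by vectors supported in those blocks (\<open>pseudospec_cols_iff\<close>), so the first
  inclusion is immediate.

  The description itself is a closed range argument. If \<open>B = A - z\<close> has an inverse of norm at
  most \<open>1 / \<epsilon>\<close>, then \<open>\<parallel>B x\<parallel> \<ge> \<epsilon> \<parallel>x\<parallel>\<close>, and duality gives the same bound for \<open>B\<^sup>T\<close>. Conversely, a
  lower bound for \<open>B\<^sup>T\<close> makes \<open>B B\<^sup>H\<close> coercive, so that a Richardson iteration solves
  \<open>B B\<^sup>H w = y\<close> for every \<open>y\<close> (\<open>mat_op_surj_if_adj_bounded_below\<close>); together with the lower bound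
  for \<open>B\<close> this yields a bounded inverse. Because the rows of a band matrix are finite, the
  iteration may be passed to the limit coordinate by coordinate, and completeness of \<open>\<ell>\<^sup>2\<close>
  enters only through Fatou's lemma.

  For the second inclusion, a vector \<open>x\<close> is cut into windows
  \<open>y\<^sup>k\<^sub>i = w (I i - k) x\<^sub>i\<close>, where \<open>I i\<close> is the block of \<open>i\<close> and
  \<open>w j = sin (j \<pi> / (n + 1))\<close> on \<open>{1..n}\<close> (\<open>shifted_op_localization\<close>). Summing over all \<open>k\<close>,
  the squared norms of the \<open>y\<^sup>k\<close> add up to \<open>\<parallel>w\<parallel>\<^sup>2 \<parallel>x\<parallel>\<^sup>2\<close>. A block-tridiagonal \<open>B\<close> almost commutes
  with the window: in row \<open>i\<close> the commutator is a difference of two neighbouring weights times the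
  sub- or superdiagonal part of \<open>B x\<close>. By Minkowski's inequality on \<open>\<int> \<times> \<int>\<close> the commutators
  contribute at most \<open>\<parallel>w'\<parallel> (\<parallel>\<alpha>\<parallel> + \<parallel>\<gamma>\<parallel>) \<parallel>x\<parallel>\<close>, with \<open>w' j = w (j + 1) - w j\<close>. The weights are the
  ground state of the discrete Dirichlet Laplacian on \<open>{1..n}\<close>, for which
  \<open>\<parallel>w'\<parallel> = 2 sin (\<pi> / (2 (n + 1))) \<parallel>w\<parallel>\<close> is the smallest possible ratio; this is where the value of
  \<^term>\<open>eps_n A n\<close> comes from. Hence a lower bound \<open>\<epsilon> + \<epsilon>\<^sub>n\<close> on every window forces the lower bound
  \<open>\<epsilon>\<close> on all of \<open>\<ell>\<^sup>2\<close>.\<close>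

section \<open>Square-summable families over an arbitrary index type\<close>

text \<open>The index type is arbitrary because the localization argument takes place in \<open>\<ell>\<^sup>2(\<int> \<times> \<int>)\<close>,
  the first index being a matrix row and the second one the position of a window.\<close>

definition l2 :: "('i \<Rightarrow> complex) \<Rightarrow> bool" where
  "l2 f \<longleftrightarrow> (\<lambda>i. (cmod (f i))\<^sup>2) summable_on UNIV"

definition l2norm :: "('i \<Rightarrow> complex) \<Rightarrow> real" where
  "l2norm f = sqrt (\<Sum>\<^sub>\<infinity>i. (cmod (f i))\<^sup>2)"

lemma mem_ell2_iff: "x \<in> ell2 \<longleftrightarrow> l2 x"
  by (simp add: ell2_def l2_def)

lemma ell2_norm_eq: "ell2_norm x = l2norm x"
  by (simp add: ell2_norm_def l2norm_def)

lemma l2norm_nonneg [simp]: "0 \<le> l2norm f"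
  by (simp add: l2norm_def infsum_nonneg)

lemma l2norm_power2: "(l2norm f)\<^sup>2 = (\<Sum>\<^sub>\<infinity>i. (cmod (f i))\<^sup>2)"
  by (simp add: l2norm_def infsum_nonneg)

text \<open>Together with \<open>L2_set_le_l2norm\<close>, this reduces Minkowski's inequality, the Cauchy-Schwarz
  inequality and Fatou's lemma for families to finite sums.\<close>

lemma l2norm_bounded_by_finite_sums:
  assumes "\<And>F. finite F \<Longrightarrow> L2_set (\<lambda>i. cmod (f i)) F \<le> C"
  shows l2_if_L2_set_bounded: "l2 f" and l2norm_le_if_L2_set_bounded: "l2norm f \<le> C"
proof -
  have C: "0 \<le> C" using assms[of "{}"] by simp
  have le: "(\<Sum>i\<in>F. (cmod (f i))\<^sup>2) \<le> C\<^sup>2" if "finite F" for F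
    using assms[OF that] C by (simp add: L2_set_def sqrt_le_D)
  show *: "l2 f" unfolding l2_def
    by (rule nonneg_bdd_above_summable_on) (auto intro!: bdd_aboveI2[where M = "C\<^sup>2"] le)
  have "(\<Sum>\<^sub>\<infinity>i. (cmod (f i))\<^sup>2) \<le> C\<^sup>2"
    using * by (intro infsum_le_finite_sums le) (auto simp: l2_def)
  then show "l2norm f \<le> C"
    unfolding l2norm_def using C by (rule real_le_lsqrt[rotated])
qed

lemma L2_set_le_l2norm:
  assumes "l2 f"
  shows "L2_set (\<lambda>i. cmod (f i)) F \<le> l2norm f"
proof (cases "finite F")
  case True
  have "(\<Sum>i\<in>F. (cmod (f i))\<^sup>2) \<le> (\<Sum>\<^sub>\<infinity>i. (cmod (f i))\<^sup>2)"
    using assms True by (intro finite_sum_le_infsum) (auto simp: l2_def)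
  then show ?thesis by (simp add: L2_set_def l2norm_def)
qed simp

lemma cmod_le_l2norm:
  assumes "l2 f"
  shows "cmod (f i) \<le> l2norm f"
  using L2_set_le_l2norm[OF assms, of "{i}"] by simp

lemma l2norm_eq_0_iff:
  assumes "l2 f"
  shows "l2norm f = 0 \<longleftrightarrow> f = (\<lambda>_. 0)"
  using cmod_le_l2norm[OF assms] by (auto simp: l2norm_def fun_eq_iff)

lemma l2_zero [simp]: "l2 (\<lambda>_. 0)" and l2norm_zero [simp]: "l2norm (\<lambda>_. 0) = 0"
  by (simp_all add: l2_def l2norm_def)

lemma assumes "l2 f" "l2 g"
  shows l2_add: "l2 (\<lambda>i. f i + g i)"
    and l2norm_triangle: "l2norm (\<lambda>i. f i + g i) \<le> l2norm f + l2norm g"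
proof -
  have "L2_set (\<lambda>i. cmod (f i + g i)) F \<le> l2norm f + l2norm g" for F
  proof -
    have "L2_set (\<lambda>i. cmod (f i + g i)) F \<le> L2_set (\<lambda>i. cmod (f i) + cmod (g i)) F"
      by (intro L2_set_mono) (auto intro: norm_triangle_ineq)
    also have "\<dots> \<le> L2_set (\<lambda>i. cmod (f i)) F + L2_set (\<lambda>i. cmod (g i)) F"
      by (rule L2_set_triangle_ineq)
    also have "\<dots> \<le> l2norm f + l2norm g"
      by (intro add_mono L2_set_le_l2norm assms)
    finally show ?thesis .
  qed
  then show "l2 (\<lambda>i. f i + g i)" "l2norm (\<lambda>i. f i + g i) \<le> l2norm f + l2norm g"
    by (blast intro: l2norm_bounded_by_finite_sums)+
qed

lemma l2_scale: "l2 f \<Longrightarrow> l2 (\<lambda>i. c * f i)"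
  and l2norm_scale: "l2norm (\<lambda>i. c * f i) = cmod c * l2norm f"
  by (auto simp: l2_def l2norm_def norm_mult power_mult_distrib infsum_cmult_right' real_sqrt_mult
      intro: summable_on_cmult_right)

lemma l2_diff: "l2 f \<Longrightarrow> l2 g \<Longrightarrow> l2 (\<lambda>i. f i - g i)"
  using l2_add[of f "\<lambda>i. -1 * g i"] l2_scale[of g "-1"] by simp

lemma l2_cnj [simp]: "l2 (\<lambda>i. cnj (f i)) \<longleftrightarrow> l2 f"
  and l2norm_cnj [simp]: "l2norm (\<lambda>i. cnj (f i)) = l2norm f"
  by (simp_all add: l2_def l2norm_def)

lemma assumes "l2 f" "\<And>i. cmod (g i) \<le> M * cmod (f i)"
  shows l2_dominated: "l2 g" and l2norm_dominated: "l2norm g \<le> \<bar>M\<bar> * l2norm f"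
proof -
  have "L2_set (\<lambda>i. cmod (g i)) F \<le> \<bar>M\<bar> * l2norm f" for F
  proof -
    have "cmod (g i) \<le> \<bar>M\<bar> * cmod (f i)" for i
      using assms(2)[of i] mult_right_mono[OF abs_ge_self norm_ge_zero, of M "f i"] by linarith
    then have "L2_set (\<lambda>i. cmod (g i)) F \<le> L2_set (\<lambda>i. \<bar>M\<bar> * cmod (f i)) F"
      by (intro L2_set_mono) auto
    also have "\<dots> = \<bar>M\<bar> * L2_set (\<lambda>i. cmod (f i)) F"
      by (simp add: L2_set_right_distrib)
    also have "\<dots> \<le> \<bar>M\<bar> * l2norm f"
      by (intro mult_left_mono L2_set_le_l2norm assms) auto
    finally show ?thesis .
  qed
  then show "l2 g" "l2norm g \<le> \<bar>M\<bar> * l2norm f"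
    by (blast intro: l2norm_bounded_by_finite_sums)+
qed

lemma assumes "bij h"
  shows l2_reindex: "l2 (\<lambda>i. f (h i)) \<longleftrightarrow> l2 f"
    and l2norm_reindex: "l2norm (\<lambda>i. f (h i)) = l2norm f"
  using summable_on_reindex_bij_betw[OF assms, of "\<lambda>i. (cmod (f i))\<^sup>2"]
    infsum_reindex_bij_betw[OF assms, of "\<lambda>i. (cmod (f i))\<^sup>2"]
  by (simp_all add: l2_def l2norm_def)

lemma bij_int_shift: "bij (\<lambda>i::int. i + k)"
  by (rule bij_betw_byWitness[of _ "\<lambda>i. i - k"]) auto

lemma bij_int_reflect: "bij (\<lambda>i::int. k - i)"
  by (rule bij_betw_byWitness[of _ "\<lambda>i. k - i"]) auto

lemma assumes "l2 f" "l2 g"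
  shows l2_mult_summable: "(\<lambda>i. f i * g i) summable_on UNIV"
    and l2_Cauchy_Schwarz: "cmod (\<Sum>\<^sub>\<infinity>i. f i * g i) \<le> l2norm f * l2norm g"
proof -
  have le: "(\<Sum>i\<in>F. cmod (f i * g i)) \<le> l2norm f * l2norm g" for F
  proof -
    have "(\<Sum>i\<in>F. cmod (f i * g i)) \<le> L2_set (\<lambda>i. cmod (f i)) F * L2_set (\<lambda>i. cmod (g i)) F"
      using L2_set_mult_ineq[of "\<lambda>i. cmod (f i)" "\<lambda>i. cmod (g i)" F] by (simp add: norm_mult)
    also have "\<dots> \<le> l2norm f * l2norm g"
      by (intro mult_mono L2_set_le_l2norm assms) auto
    finally show ?thesis .
  qed
  have abs: "(\<lambda>i. cmod (f i * g i)) summable_on UNIV"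
    by (rule nonneg_bdd_above_summable_on) (auto intro!: bdd_aboveI2 le)
  then show "(\<lambda>i. f i * g i) summable_on UNIV" by (rule abs_summable_summable)
  have "cmod (\<Sum>\<^sub>\<infinity>i. f i * g i) \<le> (\<Sum>\<^sub>\<infinity>i. cmod (f i * g i))"
    by (rule norm_infsum_bound[OF abs])
  also have "\<dots> \<le> l2norm f * l2norm g"
    by (intro infsum_le_finite_sums abs le)
  finally show "cmod (\<Sum>\<^sub>\<infinity>i. f i * g i) \<le> l2norm f * l2norm g" .
qed

lemma assumes "finite K" "\<And>k. k \<in> K \<Longrightarrow> l2 (f k)"
  shows l2_sum: "l2 (\<lambda>i. \<Sum>k\<in>K. f k i)"
    and l2norm_sum_le: "l2norm (\<lambda>i. \<Sum>k\<in>K. f k i) \<le> (\<Sum>k\<in>K. l2norm (f k))"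
proof -
  have "l2 (\<lambda>i. \<Sum>k\<in>K. f k i) \<and> l2norm (\<lambda>i. \<Sum>k\<in>K. f k i) \<le> (\<Sum>k\<in>K. l2norm (f k))"
    using assms
  proof (induction K rule: finite_induct)
    case (insert k K)
    have IH: "l2 (\<lambda>i. \<Sum>k\<in>K. f k i)" "l2norm (\<lambda>i. \<Sum>k\<in>K. f k i) \<le> (\<Sum>k\<in>K. l2norm (f k))"
      using insert by auto
    show ?case
      using l2_add[OF insert.prems(1)[of k] IH(1)] l2norm_triangle[OF insert.prems(1)[of k] IH(1)]
        IH(2) insert.hyps by simp
  qed simp
  then show "l2 (\<lambda>i. \<Sum>k\<in>K. f k i)"
    "l2norm (\<lambda>i. \<Sum>k\<in>K. f k i) \<le> (\<Sum>k\<in>K. l2norm (f k))" by auto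
qed

lemma assumes "finite S" "\<And>i. i \<notin> S \<Longrightarrow> f i = 0"
  shows l2_finite_support: "l2 f"
    and l2norm_finite_support: "(l2norm f)\<^sup>2 = (\<Sum>i\<in>S. (cmod (f i))\<^sup>2)"
proof -
  have "((\<lambda>i. (cmod (f i))\<^sup>2) has_sum (\<Sum>i\<in>S. (cmod (f i))\<^sup>2)) UNIV"
    using assms by (intro has_sum_finite_neutralI) auto
  then show "l2 f" "(l2norm f)\<^sup>2 = (\<Sum>i\<in>S. (cmod (f i))\<^sup>2)"
    by (auto simp: l2_def l2norm_power2 infsumI intro: has_sum_imp_summable)
qed

text \<open>For fixed \<open>i\<close> the sum over \<open>k\<close> runs through all values of \<open>u\<close>, whatever the reference point
  \<open>h i\<close> is. This is the reason for using all translates of one window: every coordinate of \<open>v\<close>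
  is counted with the same total weight.\<close>

lemma assumes "l2 v" "l2 u"
  shows l2_convolution: "l2 (\<lambda>(i, k). u ((h i :: int) - k) * v i)"
    and l2norm_convolution:
      "l2norm (\<lambda>(i, k). u ((h i :: int) - k) * v i) = l2norm u * l2norm v"
proof -
  define g where "g = (\<lambda>p. (cmod (case p of (i, k) \<Rightarrow> u (h i - k) * v i))\<^sup>2)"
  have inner: "((\<lambda>k. g (i, k)) has_sum (l2norm u)\<^sup>2 * (cmod (v i))\<^sup>2) UNIV" for i
  proof -
    have "((\<lambda>k. (cmod (u k))\<^sup>2) has_sum (l2norm u)\<^sup>2) UNIV"
      using assms(2) by (simp add: l2_def l2norm_power2)
    then have "((\<lambda>k. (cmod (u (h i - k)))\<^sup>2) has_sum (l2norm u)\<^sup>2) UNIV"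
      using has_sum_reindex_bij_betw[OF bij_int_reflect[of "h i"], of "\<lambda>k. (cmod (u k))\<^sup>2"] by simp
    from has_sum_cmult_left[OF this, of "(cmod (v i))\<^sup>2"] show ?thesis
      by (simp add: g_def norm_mult power_mult_distrib)
  qed
  have outer: "((\<lambda>i. (l2norm u)\<^sup>2 * (cmod (v i))\<^sup>2) has_sum (l2norm u)\<^sup>2 * (l2norm v)\<^sup>2) UNIV"
    using assms(1) by (intro has_sum_cmult_right) (simp add: l2_def l2norm_power2)
  have s: "g summable_on (UNIV \<times> UNIV)"
    by (rule summable_on_SigmaI[OF inner has_sum_imp_summable[OF outer]]) (simp add: g_def)
  then show "l2 (\<lambda>(i, k). u (h i - k) * v i)" by (simp add: l2_def g_def)
  have "(g has_sum (l2norm u)\<^sup>2 * (l2norm v)\<^sup>2) (UNIV \<times> UNIV)"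
    by (rule has_sum_SigmaI[OF inner outer s])
  then have "infsum g UNIV = (l2norm u)\<^sup>2 * (l2norm v)\<^sup>2" by (simp add: infsumI)
  then show "l2norm (\<lambda>(i, k). u (h i - k) * v i) = l2norm u * l2norm v"
    unfolding l2norm_def[of "\<lambda>(i, k). u (h i - k) * v i"] g_def[symmetric]
    by (simp add: real_sqrt_mult)
qed

text \<open>Both squared norms are sums over \<open>k\<close> of the squared norms of the slices, by Fubini.\<close>

lemma l2norm_mono_slices:
  fixes Y F :: "'i \<times> 'k \<Rightarrow> complex"
  assumes Y: "l2 Y" and F: "l2 F" and e: "0 \<le> e"
    and slices: "\<And>k. e * l2norm (\<lambda>i. Y (i, k)) \<le> l2norm (\<lambda>i. F (i, k))"
  shows "e * l2norm Y \<le> l2norm F"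
proof -
  have sq: "((\<lambda>k. (l2norm (\<lambda>i. G (i, k)))\<^sup>2) has_sum (l2norm G)\<^sup>2) UNIV" 
    if "l2 G" for G :: "'i \<times> 'k \<Rightarrow> complex"
  proof -
    have "((\<lambda>p. (cmod (G p))\<^sup>2) has_sum (l2norm G)\<^sup>2) (UNIV \<times> UNIV)"
      using that by (simp add: l2_def l2norm_power2)
    then have *: "((\<lambda>p. (cmod (G (snd p, fst p)))\<^sup>2) has_sum (l2norm G)\<^sup>2) (UNIV \<times> UNIV)"
      by (subst (asm) has_sum_swap) (simp add: case_prod_unfold)
    have "(\<lambda>i. (cmod (G (i, k)))\<^sup>2) summable_on UNIV" for k
      using summable_on_SigmaD1[of "\<lambda>k i. (cmod (G (i, k)))\<^sup>2" UNIV "\<lambda>_. UNIV" k]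
        has_sum_imp_summable[OF *] by (simp add: case_prod_unfold)
    then show ?thesis
      by (intro has_sum_SigmaD[OF *]) (simp add: l2norm_power2)
  qed
  have "e\<^sup>2 * (l2norm Y)\<^sup>2 \<le> (l2norm F)\<^sup>2"
  proof (rule has_sum_mono[OF has_sum_cmult_right[OF sq[OF Y]] sq[OF F]])
    fix k
    show "e\<^sup>2 * (l2norm (\<lambda>i. Y (i, k)))\<^sup>2 \<le> (l2norm (\<lambda>i. F (i, k)))\<^sup>2"
      using power_mono[OF slices[of k], of 2] e by (simp add: power_mult_distrib)
  qed
  then have "(e * l2norm Y)\<^sup>2 \<le> (l2norm F)\<^sup>2" by (simp add: power_mult_distrib)
  then show ?thesis by (rule power2_le_imp_le) simp
qed

text \<open>Fatou's lemma for counting measure; it replaces an appeal to completeness.\<close>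

lemma l2_pointwise_limit:
  assumes "\<And>i. (\<lambda>m. w m i) \<longlonglongrightarrow> W i" "\<And>m. l2 (w m)" "\<And>m. l2norm (w m) \<le> C"
  shows "l2 W"
proof (rule l2_if_L2_set_bounded)
  fix F :: "'a set"
  have "(\<lambda>m. L2_set (\<lambda>i. cmod (w m i)) F) \<longlonglongrightarrow> L2_set (\<lambda>i. cmod (W i)) F"
    unfolding L2_set_def by (intro tendsto_intros assms)
  moreover have "L2_set (\<lambda>i. cmod (w m i)) F \<le> C" for m
    using L2_set_le_l2norm[OF assms(2)] assms(3) by (rule order_trans)
  ultimately show "L2_set (\<lambda>i. cmod (W i)) F \<le> C"
    by (intro LIMSEQ_le_const2) auto
qed

lemma has_sum_finite_sum:
  fixes f :: "'k \<Rightarrow> 'i \<Rightarrow> 'a::topological_comm_monoid_add"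
  assumes "finite K" "\<And>k. k \<in> K \<Longrightarrow> (f k has_sum s k) B"
  shows "((\<lambda>i. \<Sum>k\<in>K. f k i) has_sum (\<Sum>k\<in>K. s k)) B"
  using assms by (induction K rule: finite_induct) (auto intro: has_sum_add)

lemma l2norm_diff_power2:
  assumes "l2 x" "l2 t"
  shows "(l2norm (\<lambda>i. x i - of_real c * t i))\<^sup>2
       = (l2norm x)\<^sup>2 - 2 * c * Re (\<Sum>\<^sub>\<infinity>i. cnj (x i) * t i) + c\<^sup>2 * (l2norm t)\<^sup>2"
proof -
  have "((\<lambda>i. (cmod (x i))\<^sup>2 + (- 2 * c) * Re (cnj (x i) * t i) + c\<^sup>2 * (cmod (t i))\<^sup>2) has_sum
      ((l2norm x)\<^sup>2 + (- 2 * c) * Re (\<Sum>\<^sub>\<infinity>i. cnj (x i) * t i) + c\<^sup>2 * (l2norm t)\<^sup>2)) UNIV"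
    using assms l2_mult_summable[of "\<lambda>i. cnj (x i)" t]
    by (intro has_sum_add has_sum_cmult_right has_sum_Re) (auto simp: l2_def l2norm_power2)
  moreover have "(cmod (x i))\<^sup>2 + (- 2 * c) * Re (cnj (x i) * t i) + c\<^sup>2 * (cmod (t i))\<^sup>2
      = (cmod (x i - of_real c * t i))\<^sup>2" for i
    unfolding cmod_power2 by (simp add: power2_eq_square algebra_simps)
  ultimately show ?thesis
    by (simp add: l2norm_power2 infsumI)
qed

section \<open>Band matrices with bounded entries\<close>

definition bounded_band :: "int \<Rightarrow> real \<Rightarrow> (int \<Rightarrow> int \<Rightarrow> complex) \<Rightarrow> bool" where
  "bounded_band b M A \<longleftrightarrow>
     (\<forall>i j. cmod (A i j) \<le> M) \<and> (\<forall>i j. A i j \<noteq> 0 \<longrightarrow> \<bar>i - j\<bar> \<le> b)"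

lemma bounded_band_adj [simp]: "bounded_band b M (adj A) \<longleftrightarrow> bounded_band b M A"
  unfolding bounded_band_def adj_def by (metis abs_minus_commute)

lemma bounded_band_nonneg: "bounded_band b M A \<Longrightarrow> 0 \<le> M"
  using norm_ge_zero order_trans unfolding bounded_band_def by blast

lemma mat_op_finite_sum:
  assumes "finite J" "\<And>j. A i j \<noteq> 0 \<Longrightarrow> j \<in> J"
  shows "mat_op A x i = (\<Sum>j\<in>J. A i j * x j)"
proof -
  have "mat_op A x i = infsum (\<lambda>j. A i j * x j) J"
    unfolding mat_op_def using assms(2) by (intro infsum_cong_neutral) auto
  then show ?thesis using assms(1) by simp
qed

lemma mat_op_band:
  assumes "bounded_band b M A"
  shows "mat_op A x i = (\<Sum>k\<in>{-b..b}. A i (i + k) * x (i + k))"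
proof -
  have "mat_op A x i = (\<Sum>j\<in>{i-b..i+b}. A i j * x j)"
    using assms by (intro mat_op_finite_sum) (force simp: bounded_band_def)+
  also have "\<dots> = (\<Sum>k\<in>{-b..b}. A i (i + k) * x (i + k))"
    by (rule sum.reindex_bij_witness[of _ "\<lambda>k. i + k" "\<lambda>j. j - i"]) auto
  finally show ?thesis .
qed

lemma mat_op_sum:
  assumes "bounded_band b M A"
  shows "mat_op A (\<lambda>i. \<Sum>k\<in>K. f k i) i = (\<Sum>k\<in>K. mat_op A (f k) i)"
  unfolding mat_op_band[OF assms] sum_distrib_left by (rule sum.swap)

lemma mat_op_scale:
  assumes "bounded_band b M A"
  shows "mat_op A (\<lambda>i. c * f i) i = c * mat_op A f i"
  unfolding mat_op_band[OF assms] by (simp add: sum_distrib_left mult.left_commute)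

lemma mat_op_diff:
  assumes "bounded_band b M A"
  shows "mat_op A (\<lambda>i. f i - g i) i = mat_op A f i - mat_op A g i"
  unfolding mat_op_band[OF assms] by (simp add: sum_subtractf algebra_simps)

lemma tendsto_mat_op:
  assumes "bounded_band b M A" "\<And>i. (\<lambda>m. w m i) \<longlonglongrightarrow> W i"
  shows "(\<lambda>m. mat_op A (w m) i) \<longlonglongrightarrow> mat_op A W i"
  unfolding mat_op_band[OF assms(1)] by (intro tendsto_intros assms)

lemma assumes "bounded_band b M A" "l2 x"
  shows l2_mat_op: "l2 (mat_op A x)"
    and l2norm_mat_op_le: "l2norm (mat_op A x) \<le> real (card {-b..b}) * M * l2norm x"
proof -
  have eq: "mat_op A x = (\<lambda>i. \<Sum>k\<in>{-b..b}. A i (i + k) * x (i + k))"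
    using mat_op_band[OF assms(1)] by blast
  have x: "l2 (\<lambda>i. x (i + k))" "l2norm (\<lambda>i. x (i + k)) = l2norm x" for k
    using l2_reindex[OF bij_int_shift, of x k] l2norm_reindex[OF bij_int_shift, of x k] assms
    by auto
  have le: "cmod (A i (i + k) * x (i + k)) \<le> M * cmod (x (i + k))" for i k
    using assms(1) by (auto simp: bounded_band_def norm_mult intro!: mult_right_mono)
  have l2: "l2 (\<lambda>i. A i (i + k) * x (i + k))" for k
    by (rule l2_dominated[OF x(1) le])
  have norm: "l2norm (\<lambda>i. A i (i + k) * x (i + k)) \<le> M * l2norm x" for k
    using l2norm_dominated[OF x(1) le, of k] x(2) bounded_band_nonneg[OF assms(1)] by simp
  show "l2 (mat_op A x)" unfolding eq by (intro l2_sum l2) auto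
  have "l2norm (mat_op A x) \<le> (\<Sum>k\<in>{-b..b}. l2norm (\<lambda>i. A i (i + k) * x (i + k)))"
    unfolding eq by (intro l2norm_sum_le l2) auto
  also have "\<dots> \<le> real (card {-b..b}) * (M * l2norm x)"
    by (intro sum_bounded_above norm)
  finally show "l2norm (mat_op A x) \<le> real (card {-b..b}) * M * l2norm x"
    by (simp add: mult.assoc)
qed

text \<open>After splitting the matrix into its finitely many diagonals, each diagonal is a weighted shift,
  for which moving the shift to the other factor is a change of the summation index.\<close>

lemma mat_op_adj_duality:
  assumes A: "bounded_band b M A" and x: "l2 x" and y: "l2 y"
  shows "(\<Sum>\<^sub>\<infinity>i. x i * mat_op A y i) = (\<Sum>\<^sub>\<infinity>j. mat_op (adj A) x j * y j)"
proof -
  have At: "bounded_band b M (adj A)" using A by simp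
  define t where "t k i = x i * (A i (i + k) * y (i + k))" for k i
  have bound: "cmod (A i j) \<le> M" for i j using A by (simp add: bounded_band_def)
  have y': "l2 (\<lambda>i. y (i + k))" for k
    using l2_reindex[OF bij_int_shift, of y k] y by simp
  have "l2 (\<lambda>i. A i (i + k) * y (i + k))" for k
    by (rule l2_dominated[OF y', of _ M]) (auto simp: norm_mult intro!: mult_right_mono bound)
  then have s: "(t k has_sum infsum (t k) UNIV) UNIV" for k
    unfolding t_def using l2_mult_summable[OF x] by simp
  have L: "((\<lambda>i. x i * mat_op A y i) has_sum (\<Sum>k\<in>{-b..b}. infsum (t k) UNIV)) UNIV"
    using has_sum_finite_sum[where f = t and K = "{-b..b}", OF _ s]
    by (simp add: mat_op_band[OF A] t_def sum_distrib_left)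
  have "((\<lambda>j. t (-k) (j + k)) has_sum infsum (t (-k)) UNIV) UNIV" for k
    using has_sum_reindex_bij_betw[OF bij_int_shift[of k], of "t (-k)"] s by simp
  then have "((\<lambda>j. \<Sum>k\<in>{-b..b}. t (-k) (j + k)) has_sum (\<Sum>k\<in>{-b..b}. infsum (t (-k)) UNIV)) UNIV"
    by (intro has_sum_finite_sum) auto
  moreover have "(\<Sum>k\<in>{-b..b}. infsum (t (-k)) UNIV) = (\<Sum>k\<in>{-b..b}. infsum (t k) UNIV)"
    by (rule sum.reindex_bij_witness[of _ uminus uminus]) auto
  moreover have "(\<Sum>k\<in>{-b..b}. t (-k) (j + k)) = mat_op (adj A) x j * y j" for j
    unfolding mat_op_band[OF At] by (simp add: t_def adj_def sum_distrib_left sum_distrib_right mult_ac)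
  ultimately have "((\<lambda>j. mat_op (adj A) x j * y j) has_sum (\<Sum>k\<in>{-b..b}. infsum (t k) UNIV)) UNIV"
    by simp
  with L show ?thesis by (simp add: infsumI)
qed

text \<open>With \<open>H\<close> the conjugate transpose of \<open>A\<close>, the operator \<open>T = A H\<close> satisfies
  \<open>\<langle>x, T x\<rangle> = \<parallel>H x\<parallel>\<^sup>2 \<ge> e\<^sup>2 \<parallel>x\<parallel>\<^sup>2\<close>, so that \<open>x \<mapsto> x - c T x\<close> is a contraction for small \<open>c > 0\<close>. The
  corresponding Neumann series for \<open>T w = y\<close> is summed coordinatewise.\<close>

lemma mat_op_surj_if_adj_bounded_below:
  assumes A: "bounded_band b M A" and e: "0 < e"
    and below: "\<And>x. l2 x \<Longrightarrow> e * l2norm x \<le> l2norm (mat_op (adj A) x)"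
    and y: "l2 y"
  obtains v where "l2 v" "mat_op A v = y"
proof -
  have At: "bounded_band b M (adj A)" using A by simp
  define H where "H x = (\<lambda>j. cnj (mat_op (adj A) (\<lambda>i. cnj (x i)) j))" for x :: "int \<Rightarrow> complex"
  define T where "T x = mat_op A (H x)" for x
  define C where "C = real (card {-b..b}) * M"
  have C: "0 \<le> C" using bounded_band_nonneg[OF A] by (simp add: C_def)
  have H: "l2 (H x)" "l2norm (H x) \<le> C * l2norm x" "e * l2norm x \<le> l2norm (H x)" if "l2 x" for x
    using l2_mat_op[OF At, of "\<lambda>i. cnj (x i)"] l2norm_mat_op_le[OF At, of "\<lambda>i. cnj (x i)"]
      below[of "\<lambda>i. cnj (x i)"] that by (simp_all add: H_def C_def)
  have T: "l2 (T x)" "l2norm (T x) \<le> C\<^sup>2 * l2norm x" if "l2 x" for x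
  proof -
    show "l2 (T x)" unfolding T_def by (intro l2_mat_op[OF A] H that)
    have "l2norm (T x) \<le> C * l2norm (H x)"
      unfolding T_def C_def by (intro l2norm_mat_op_le[OF A] H that)
    also have "\<dots> \<le> C * (C * l2norm x)" by (intro mult_left_mono H that C)
    finally show "l2norm (T x) \<le> C\<^sup>2 * l2norm x" by (simp add: power2_eq_square mult.assoc)
  qed
  have coercive: "Re (\<Sum>\<^sub>\<infinity>i. cnj (x i) * T x i) = (l2norm (H x))\<^sup>2" if "l2 x" for x
  proof -
    have "(\<Sum>\<^sub>\<infinity>i. cnj (x i) * T x i) = (\<Sum>\<^sub>\<infinity>j. mat_op (adj A) (\<lambda>i. cnj (x i)) j * H x j)"
      unfolding T_def using that by (intro mat_op_adj_duality[OF A] H) auto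
    also have "\<dots> = (\<Sum>\<^sub>\<infinity>j. of_real ((cmod (H x j))\<^sup>2))"
      by (simp only: H_def complex_norm_square complex_mod_cnj)
    also have "\<dots> = of_real ((l2norm (H x))\<^sup>2)"
      using H(1)[OF that] by (intro infsumI has_sum_of_real) (simp add: l2_def l2norm_power2)
    finally show ?thesis by simp
  qed
  \<comment> \<open>\<open>K\<close> bounds \<open>\<parallel>T\<parallel>\<close>, and \<open>c\<close> minimizes \<open>1 - 2 c e\<^sup>2 + c\<^sup>2 K\<^sup>2\<close>, the resulting bound on the
      squared norm of \<open>1 - c T\<close>. The summand \<open>e\<^sup>2\<close> makes \<open>K\<close> positive and keeps \<open>q\<close> real.\<close>
  define K where "K = C\<^sup>2 + e\<^sup>2"
  define c where "c = e\<^sup>2 / K\<^sup>2"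
  define q where "q = sqrt (1 - (e\<^sup>2 / K)\<^sup>2)"
  have K: "0 < K" "e\<^sup>2 \<le> K" "C\<^sup>2 \<le> K" using e by (auto simp: K_def intro: add_nonneg_pos)
  have c: "0 < c" using e K by (simp add: c_def)
  have r: "0 < e\<^sup>2 / K" "e\<^sup>2 / K \<le> 1" using e K by (simp_all add: field_simps)
  then have "(e\<^sup>2 / K)\<^sup>2 \<le> 1" "0 < (e\<^sup>2 / K)\<^sup>2" by (auto simp: power_le_one simp del: power_divide)
  then have q: "0 \<le> q" "q < 1" "q\<^sup>2 = 1 - (e\<^sup>2 / K)\<^sup>2" unfolding q_def by auto
  have contraction: "l2norm (\<lambda>i. x i - of_real c * T x i) \<le> q * l2norm x" if x: "l2 x" for x
  proof (rule power2_le_imp_le)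
    have "(e * l2norm x)\<^sup>2 \<le> (l2norm (H x))\<^sup>2"
      using H(3)[OF x] e by (intro power_mono) auto
    moreover have "l2norm (T x) \<le> K * l2norm x"
      using T(2)[OF x] mult_right_mono[OF K(3), of "l2norm x"] by simp
    then have "(l2norm (T x))\<^sup>2 \<le> (K * l2norm x)\<^sup>2"
      by (intro power_mono) auto
    ultimately have "(l2norm x)\<^sup>2 - 2 * c * (l2norm (H x))\<^sup>2 + c\<^sup>2 * (l2norm (T x))\<^sup>2
        \<le> (l2norm x)\<^sup>2 - 2 * c * (e * l2norm x)\<^sup>2 + c\<^sup>2 * (K * l2norm x)\<^sup>2"
      using c by (intro add_mono diff_mono mult_left_mono) auto
    also have "\<dots> = (1 - 2 * (c * e\<^sup>2) + (c * K)\<^sup>2) * (l2norm x)\<^sup>2"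
      by (simp add: power_mult_distrib algebra_simps)
    also have "\<dots> = (1 - (e\<^sup>2 / K)\<^sup>2) * (l2norm x)\<^sup>2"
      using K(1) by (simp add: c_def power2_eq_square)
    finally show "(l2norm (\<lambda>i. x i - of_real c * T x i))\<^sup>2 \<le> (q * l2norm x)\<^sup>2"
      using l2norm_diff_power2[OF x T(1)[OF x], of c] coercive[OF x] q(3)
      by (simp add: power_mult_distrib)
  qed (use q in auto)
  \<comment> \<open>\<open>\<delta> m\<close> is the \<open>m\<close>-th term \<open>(1 - c T)\<^sup>m c y\<close> of the Neumann series, \<open>w m\<close> a partial sum.\<close>
  define \<delta> where "\<delta> = rec_nat (\<lambda>i. of_real c * y i) (\<lambda>_ x i. x i - of_real c * T x i)"
  have \<delta>_0: "\<delta> 0 = (\<lambda>i. of_real c * y i)"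
    and \<delta>_Suc: "\<delta> (Suc m) = (\<lambda>i. \<delta> m i - of_real c * T (\<delta> m) i)" for m
    by (simp_all add: \<delta>_def)
  have l2\<delta>: "l2 (\<delta> m)" for m
    by (induction m) (auto simp: \<delta>_0 \<delta>_Suc y intro!: l2_scale l2_diff T)
  have norm\<delta>: "l2norm (\<delta> m) \<le> l2norm (\<delta> 0) * q ^ m" for m
  proof (induction m)
    case (Suc m)
    have "l2norm (\<delta> (Suc m)) \<le> q * l2norm (\<delta> m)"
      unfolding \<delta>_Suc by (rule contraction[OF l2\<delta>])
    also have "\<dots> \<le> q * (l2norm (\<delta> 0) * q ^ m)" by (intro mult_left_mono Suc q)
    finally show ?case by (simp add: mult_ac)
  qed simp
  have geo: "summable (\<lambda>m. l2norm (\<delta> 0) * q ^ m)"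
    using q by (intro summable_mult summable_geometric) auto
  have sum\<delta>: "summable (\<lambda>m. \<delta> m i)" for i
    by (rule summable_comparison_test'[OF geo])
      (rule order_trans[OF cmod_le_l2norm[OF l2\<delta>] norm\<delta>])
  define w where "w m = (\<lambda>i. \<Sum>k<m. \<delta> k i)" for m
  define W where "W i = (\<Sum>m. \<delta> m i)" for i
  have lim: "(\<lambda>m. w m i) \<longlonglongrightarrow> W i" for i
    unfolding w_def W_def by (rule summable_LIMSEQ[OF sum\<delta>])
  have l2W: "l2 W"
  proof (rule l2_pointwise_limit[OF lim])
    fix m
    show "l2 (w m)" unfolding w_def by (intro l2_sum l2\<delta>) auto
    have "l2norm (w m) \<le> (\<Sum>k<m. l2norm (\<delta> k))" unfolding w_def by (intro l2norm_sum_le l2\<delta>) auto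
    also have "\<dots> \<le> (\<Sum>k<m. l2norm (\<delta> 0) * q ^ k)" by (intro sum_mono norm\<delta>)
    also have "\<dots> \<le> (\<Sum>k. l2norm (\<delta> 0) * q ^ k)"
      using q by (intro sum_le_suminf[OF geo]) auto
    finally show "l2norm (w m) \<le> (\<Sum>k. l2norm (\<delta> 0) * q ^ k)" .
  qed
  have limT: "(\<lambda>m. T (w m) i) \<longlonglongrightarrow> T W i" for i
    unfolding T_def H_def
    by (intro tendsto_mat_op[OF A] tendsto_cnj tendsto_mat_op[OF At] lim)
  have "T (w m) i = (\<Sum>k<m. T (\<delta> k) i)" for m i
    unfolding T_def H_def w_def by (simp add: mat_op_sum[OF A] mat_op_sum[OF At])
  then have "of_real c * T (w m) i = (\<Sum>k<m. \<delta> k i - \<delta> (Suc k) i)" for m i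
    by (simp add: sum_distrib_left \<delta>_Suc)
  then have telescope: "of_real c * T (w m) i = of_real c * y i - \<delta> m i" for m i
    using sum_lessThan_telescope'[of "\<lambda>k. \<delta> k i" m] unfolding \<delta>_0 by metis
  have "T W i = y i" for i
  proof -
    have "(\<lambda>m. of_real c * y i - \<delta> m i) \<longlonglongrightarrow> of_real c * y i - 0"
      by (intro tendsto_diff tendsto_const summable_LIMSEQ_zero sum\<delta>)
    moreover have "(\<lambda>m. of_real c * y i - \<delta> m i) \<longlonglongrightarrow> of_real c * T W i"
      using tendsto_mult[OF tendsto_const limT, of "of_real c" i] by (simp add: telescope)
    ultimately have "of_real c * y i = (of_real c * T W i :: complex)"
      by (metis LIMSEQ_unique diff_zero)
    then show ?thesis using c by simp
  qed
  then have "mat_op A (H W) = y" unfolding T_def by blast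
  then show thesis using that H(1)[OF l2W] by blast
qed

section \<open>The sine window\<close>

text \<open>The ground state of the discrete Dirichlet Laplacian on \<open>{1..n}\<close>. The interval includes the two
  zeros \<open>0\<close> and \<open>n + 1\<close> of the sine so that both boundary differences are differences of sines.\<close>

definition sine_bump :: "nat \<Rightarrow> int \<Rightarrow> real" where
  "sine_bump n j = (if 0 \<le> j \<and> j \<le> int n + 1 then sin (of_int j * (pi / (real n + 1))) else 0)"

lemma sine_bump_support: "sine_bump n j \<noteq> 0 \<Longrightarrow> j \<in> {1..int n}"
proof -
  assume *: "sine_bump n j \<noteq> 0"
  have "sine_bump n 0 = 0" "sine_bump n (int n + 1) = 0"
    by (simp_all add: sine_bump_def)
  with * have "j \<noteq> 0" "j \<noteq> int n + 1" by metis+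
  with * show ?thesis by (auto simp: sine_bump_def split: if_splits)
qed

text \<open>The summand telescopes because \<open>s j = sin (j \<theta>)\<close> satisfies \<open>s (j + 1) + s (j - 1) = 2 cos \<theta> s j\<close>.
  The right-hand side vanishes at \<open>m = n + 1\<close> for \<open>\<theta> = \<pi> / (n + 1)\<close>, leaving the eigenvalue
  \<open>2 - 2 cos \<theta> = (2 sin (\<theta> / 2))\<^sup>2\<close> as the ratio of the two squared norms.\<close>

lemma sum_sine_differences:
  fixes \<theta> :: real
  shows "(\<Sum>j<m. (sin ((real j + 1) * \<theta>) - sin (real j * \<theta>))\<^sup>2 - (2 - 2 * cos \<theta>) * (sin (real j * \<theta>))\<^sup>2)
       = sin (real m * \<theta>) * (sin (real m * \<theta>) - sin ((real m - 1) * \<theta>))"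
proof (induction m)
  case (Suc m)
  define s c where "s = sin (real m * \<theta>)" and "c = cos \<theta>"
  define s1 s0 where "s1 = sin ((real m + 1) * \<theta>)" and "s0 = sin ((real m - 1) * \<theta>)"
  have rec: "s0 = 2 * c * s - s1"
    by (simp add: s_def c_def s1_def s0_def ring_distribs left_diff_distrib sin_add sin_diff)
  have "s * (s - s0) + ((s1 - s)\<^sup>2 - (2 - 2 * c) * s\<^sup>2) = s1 * (s1 - s)"
    unfolding rec by (simp add: power2_eq_square algebra_simps)
  with Suc show ?case by (simp add: s_def c_def s1_def s0_def add.commute)
qed simp

lemma l2_sine_bump: "l2 (\<lambda>j. complex_of_real (sine_bump n j))"
  and l2_sine_bump_diff: "l2 (\<lambda>j. complex_of_real (sine_bump n (j + 1) - sine_bump n j))"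
  and l2norm_sine_bump_diff:
    "l2norm (\<lambda>j. complex_of_real (sine_bump n (j + 1) - sine_bump n j))
       = 2 * sin (pi / (2 * (real n + 1))) * l2norm (\<lambda>j. complex_of_real (sine_bump n j))"
proof -
  define \<theta> where "\<theta> = pi / (real n + 1)"
  let ?w = "\<lambda>j. complex_of_real (sine_bump n j)"
  let ?u = "\<lambda>j. complex_of_real (sine_bump n (j + 1) - sine_bump n j)"
  let ?S = "int ` {..<n + 1}"
  have supp: "?w j = 0" "?u j = 0" if "j \<notin> ?S" for j
  proof -
    have "\<not> (0 \<le> j \<and> j \<le> int n)"
      using that by (auto simp: image_iff dest: bspec[of _ _ "nat j"])
    then have "j \<notin> {1..int n}" "j + 1 \<notin> {1..int n}" by auto
    then have "sine_bump n j = 0" "sine_bump n (j + 1) = 0" using sine_bump_support by metis+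
    then show "?w j = 0" "?u j = 0" by simp_all
  qed
  show l2: "l2 ?w" "l2 ?u" by (rule l2_finite_support[of ?S]; use supp in auto)+
  have w: "sine_bump n (int j) = sin (real j * \<theta>)" if "j \<le> n + 1" for j
    using that by (simp add: sine_bump_def \<theta>_def)
  have "(l2norm ?w)\<^sup>2 = (\<Sum>j\<in>?S. (cmod (?w j))\<^sup>2)"
    using supp by (intro l2norm_finite_support) auto
  also have "\<dots> = (\<Sum>j<n + 1. (sine_bump n (int j))\<^sup>2)"
    by (subst sum.reindex) auto
  also have "\<dots> = (\<Sum>j<n + 1. (sin (real j * \<theta>))\<^sup>2)"
    by (intro sum.cong refl) (simp add: w)
  finally have W: "(l2norm ?w)\<^sup>2 = (\<Sum>j<n + 1. (sin (real j * \<theta>))\<^sup>2)" .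
  have "(l2norm ?u)\<^sup>2 = (\<Sum>j\<in>?S. (cmod (?u j))\<^sup>2)"
    using supp by (intro l2norm_finite_support) auto
  also have "\<dots> = (\<Sum>j<n + 1. (sine_bump n (int j + 1) - sine_bump n (int j))\<^sup>2)"
    by (subst sum.reindex) (auto simp del: of_real_diff)
  also have "\<dots> = (\<Sum>j<n + 1. (sin ((real j + 1) * \<theta>) - sin (real j * \<theta>))\<^sup>2)"
  proof (intro sum.cong refl)
    fix j assume "j \<in> {..<n + 1}"
    then have "sine_bump n (int (j + 1)) = sin (real (j + 1) * \<theta>)" "sine_bump n (int j) = sin (real j * \<theta>)"
      by (intro w; simp)+
    then show "(sine_bump n (int j + 1) - sine_bump n (int j))\<^sup>2
        = (sin ((real j + 1) * \<theta>) - sin (real j * \<theta>))\<^sup>2"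
      by (simp add: add.commute)
  qed
  also have "\<dots> = (2 - 2 * cos \<theta>) * (l2norm ?w)\<^sup>2"
  proof -
    have "real (n + 1) * \<theta> = pi" by (simp add: \<theta>_def field_simps)
    then have "(\<Sum>j<n + 1. (sin ((real j + 1) * \<theta>) - sin (real j * \<theta>))\<^sup>2
        - (2 - 2 * cos \<theta>) * (sin (real j * \<theta>))\<^sup>2) = 0"
      unfolding sum_sine_differences by simp
    then show ?thesis unfolding W by (simp add: sum_subtractf sum_distrib_left del: sum.lessThan_Suc)
  qed
  also have "2 - 2 * cos \<theta> = (2 * sin (\<theta> / 2))\<^sup>2"
    using cos_double_sin[of "\<theta> / 2"] by (simp add: power_mult_distrib)
  finally have "(l2norm ?u)\<^sup>2 = (2 * sin (\<theta> / 2) * l2norm ?w)\<^sup>2"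
    by (simp add: power_mult_distrib)
  moreover have "0 \<le> sin (\<theta> / 2)"
    by (intro sin_ge_zero) (auto simp: \<theta>_def divide_le_eq)
  ultimately have "l2norm ?u = 2 * sin (\<theta> / 2) * l2norm ?w"
    by (simp add: power2_eq_iff_nonneg)
  then show "l2norm ?u = 2 * sin (pi / (2 * (real n + 1))) * l2norm ?w"
    by (simp add: \<theta>_def mult.commute)
qed

lemma l2norm_sine_bump_pos:
  assumes "1 \<le> n"
  shows "0 < l2norm (\<lambda>j. complex_of_real (sine_bump n j))"
proof -
  have "0 < sin (pi / (real n + 1))"
    using assms by (intro sin_gt_zero) (auto simp: divide_less_eq)
  then have "0 < cmod (complex_of_real (sine_bump n 1))" by (simp add: sine_bump_def)
  with cmod_le_l2norm[OF l2_sine_bump, of n 1] show ?thesis by linarith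
qed

section \<open>Block diagonals\<close>

lemma assumes "0 < d" "finite G"
  shows finite_block_union: "finite {i. i div int d \<in> G}"
    and sum_block_union: "(\<Sum>i | i div int d \<in> G. f i) = (\<Sum>I\<in>G. \<Sum>r<d. f (I * int d + int r))"
proof -
  have "{i. i div int d \<in> G} \<subseteq> (\<lambda>(I, r). I * int d + int r) ` (G \<times> {..<d})"
  proof
    fix i assume "i \<in> {i. i div int d \<in> G}"
    then show "i \<in> (\<lambda>(I, r). I * int d + int r) ` (G \<times> {..<d})"
      using assms(1) by (intro image_eqI[of _ _ "(i div int d, nat (i mod int d))"]) (auto simp: nat_less_iff)
  qed
  then show "finite {i. i div int d \<in> G}"
    by (rule finite_subset) (use assms in auto)
  have "(\<Sum>i | i div int d \<in> G. f i) = (\<Sum>(I, r)\<in>G \<times> {..<d}. f (I * int d + int r))"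
    using assms(1)
    by (intro sum.reindex_bij_witness[of _ "\<lambda>(I, r). I * int d + int r"
            "\<lambda>i. (i div int d, nat (i mod int d))"]) (auto simp: nat_less_iff)
  then show "(\<Sum>i | i div int d \<in> G. f i) = (\<Sum>I\<in>G. \<Sum>r<d. f (I * int d + int r))"
    using assms(2) by (simp add: sum.cartesian_product)
qed

text \<open>The contribution of the \<open>t\<close>-th block diagonal to \<open>A x\<close>: row block \<open>I\<close> meets column block \<open>I + t\<close>.\<close>

definition block_diagonal_op ::
    "nat \<Rightarrow> (int \<Rightarrow> int \<Rightarrow> complex) \<Rightarrow> int \<Rightarrow> (int \<Rightarrow> complex) \<Rightarrow> int \<Rightarrow> complex" where
  "block_diagonal_op d A t x i =
     (\<Sum>s<d. A i ((i div int d + t) * int d + int s) * x ((i div int d + t) * int d + int s))"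

definition block_diagonal_bounded :: "nat \<Rightarrow> (int \<Rightarrow> int \<Rightarrow> complex) \<Rightarrow> int \<Rightarrow> real \<Rightarrow> bool" where
  "block_diagonal_bounded d A t a \<longleftrightarrow>
     (\<forall>I v. L2_set (\<lambda>r. cmod (\<Sum>s<d. block d A I (I + t) r s * v s)) {..<d}
            \<le> a * L2_set (\<lambda>s. cmod (v s)) {..<d})"

text \<open>Different row blocks use disjoint parts of \<open>x\<close>, so the squared bounds for the single blocks add
  up without loss.\<close>

lemma assumes d: "0 < d" and a: "0 \<le> a" "block_diagonal_bounded d A t a" and x: "l2 x"
  shows l2_block_diagonal_op: "l2 (block_diagonal_op d A t x)"
    and l2norm_block_diagonal_op_le: "l2norm (block_diagonal_op d A t x) \<le> a * l2norm x"
proof -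
  let ?p = "block_diagonal_op d A t x"
  have bound: "L2_set (\<lambda>i. cmod (?p i)) F \<le> a * l2norm x" if F: "finite F" for F
  proof -
    define G where "G = (\<lambda>i. i div int d) ` F"
    have G: "finite G" using F by (simp add: G_def)
    have "(\<Sum>i\<in>F. (cmod (?p i))\<^sup>2) \<le> (\<Sum>i | i div int d \<in> G. (cmod (?p i))\<^sup>2)"
      by (intro sum_mono2 finite_block_union[OF d G]) (auto simp: G_def)
    also have "\<dots> = (\<Sum>I\<in>G. \<Sum>r<d. (cmod (?p (I * int d + int r)))\<^sup>2)"
      by (rule sum_block_union[OF d G])
    also have "\<dots> \<le> (\<Sum>I\<in>G. a\<^sup>2 * (\<Sum>s<d. (cmod (x ((I + t) * int d + int s)))\<^sup>2))"
    proof (intro sum_mono)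
      fix I
      define v where "v s = x ((I + t) * int d + int s)" for s :: nat
      have "?p (I * int d + int r) = (\<Sum>s<d. block d A I (I + t) r s * v s)" if "r < d" for r
        using that by (simp add: block_diagonal_op_def block_def v_def)
      then have "(\<Sum>r<d. (cmod (?p (I * int d + int r)))\<^sup>2)
          = (L2_set (\<lambda>r. cmod (\<Sum>s<d. block d A I (I + t) r s * v s)) {..<d})\<^sup>2"
        by (simp add: L2_set_def sum_nonneg)
      also have "\<dots> \<le> (a * L2_set (\<lambda>s. cmod (v s)) {..<d})\<^sup>2"
        using a by (intro power_mono) (auto simp: block_diagonal_bounded_def)
      also have "\<dots> = a\<^sup>2 * (\<Sum>s<d. (cmod (v s))\<^sup>2)"
        by (simp add: power_mult_distrib L2_set_def sum_nonneg)
      finally show "(\<Sum>r<d. (cmod (?p (I * int d + int r)))\<^sup>2)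
          \<le> a\<^sup>2 * (\<Sum>s<d. (cmod (x ((I + t) * int d + int s)))\<^sup>2)" by (simp add: v_def)
    qed
    also have "\<dots> = a\<^sup>2 * (\<Sum>J\<in>(\<lambda>I. I + t) ` G. \<Sum>s<d. (cmod (x (J * int d + int s)))\<^sup>2)"
      by (subst sum.reindex) (auto simp: sum_distrib_left inj_on_def)
    also have "\<dots> = a\<^sup>2 * (\<Sum>j | j div int d \<in> (\<lambda>I. I + t) ` G. (cmod (x j))\<^sup>2)"
      by (subst sum_block_union[OF d]) (use G in auto)
    also have "\<dots> \<le> a\<^sup>2 * (l2norm x)\<^sup>2"
      unfolding l2norm_power2 using x G
      by (intro mult_left_mono finite_sum_le_infsum finite_block_union[OF d]) (auto simp: l2_def)
    finally show ?thesis
      using a(1) unfolding L2_set_def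
      by (intro real_le_lsqrt) (auto simp: power_mult_distrib)
  qed
  show "l2 ?p" "l2norm ?p \<le> a * l2norm x" by (rule l2norm_bounded_by_finite_sums, rule bound, assumption)+
qed

definition block_tridiagonal :: "nat \<Rightarrow> (int \<Rightarrow> int \<Rightarrow> complex) \<Rightarrow> bool" where
  "block_tridiagonal d A \<longleftrightarrow> (\<forall>i j. A i j \<noteq> 0 \<longrightarrow> \<bar>i div int d - j div int d\<bar> \<le> 1)"

lemma mat_op_block_tridiagonal:
  assumes "0 < d" "block_tridiagonal d A"
  shows "mat_op A x i
       = block_diagonal_op d A (-1) x i + block_diagonal_op d A 0 x i + block_diagonal_op d A 1 x i"
proof -
  let ?I = "i div int d"
  have "mat_op A x i = (\<Sum>j | j div int d \<in> {?I + -1, ?I + 0, ?I + 1}. A i j * x j)"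
  proof (rule mat_op_finite_sum[OF finite_block_union[OF assms(1)]])
    have near: "J \<in> {m + -1, m + 0, m + 1}" if "\<bar>m - J\<bar> \<le> 1" for m J :: int
      using that by (simp; linarith)
    fix j assume "A i j \<noteq> 0"
    then have "\<bar>?I - j div int d\<bar> \<le> 1" using assms(2) by (simp add: block_tridiagonal_def)
    from near[OF this] show "j \<in> {j. j div int d \<in> {?I + -1, ?I + 0, ?I + 1}}" by blast
  qed simp
  also have "\<dots> = (\<Sum>J\<in>{?I + -1, ?I + 0, ?I + 1}. \<Sum>s<d. A i (J * int d + int s) * x (J * int d + int s))"
    by (rule sum_block_union[OF assms(1)]) simp
  also have "\<dots> = block_diagonal_op d A (-1) x i + block_diagonal_op d A 0 x i + block_diagonal_op d A 1 x i"
    by (simp add: block_diagonal_op_def)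
  finally show ?thesis .
qed

lemma block_diagonal_op_weight:
  assumes "0 < d"
  shows "block_diagonal_op d A t (\<lambda>j. f (j div int d) * x j) i = f (i div int d + t) * block_diagonal_op d A t x i"
proof -
  have "(J * int d + int s) div int d = J" if "s < d" for J s using that by simp
  then show ?thesis
    unfolding block_diagonal_op_def sum_distrib_left by (intro sum.cong refl) simp
qed

section \<open>Localization to windows of finitely many blocks\<close>

text \<open>The diagonal blocks and the shift by \<open>z\<close> commute with a weight that is constant on blocks; only
  the two off-diagonal parts \<open>p\<close> and \<open>q\<close> of \<open>A x\<close> enter the error term. The estimate
  \<open>\<parallel>F\<parallel> \<le> \<parallel>G\<parallel> + \<parallel>P\<parallel> + \<parallel>Q\<parallel>\<close> is applied to the whole family of windows at once; no single window is
  selected.\<close>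

lemma shifted_op_localization:
  assumes d: "0 < d" and A: "bounded_band b M A" "block_tridiagonal d A"
    and a: "0 \<le> a" "block_diagonal_bounded d A (-1) a"
    and g: "0 \<le> g" "block_diagonal_bounded d A 1 g"
    and n: "1 \<le> n" and e: "0 \<le> e"
    and lower: "\<And>k y. y \<in> block_supported d n k \<Longrightarrow> e * l2norm y \<le> l2norm (shifted_op A z y)"
    and x: "l2 x"
  shows "(e - 2 * (a + g) * sin (pi / (2 * (real n + 1)))) * l2norm x \<le> l2norm (shifted_op A z x)"
proof -
  let ?w = "\<lambda>j. complex_of_real (sine_bump n j)"
  let ?u = "\<lambda>j. complex_of_real (sine_bump n (j + 1) - sine_bump n j)"
  let ?p = "block_diagonal_op d A (-1) x"
  let ?q = "block_diagonal_op d A 1 x"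
  let ?B = "shifted_op A z"
  let ?I = "\<lambda>i. i div int d"
  have Bx: "l2 (?B x)"
    unfolding shifted_op_def by (intro l2_diff l2_scale l2_mat_op[OF A(1)] x)
  define Y where "Y = (\<lambda>(i, k). ?w (?I i - k) * x i)"
  define F where "F = (\<lambda>(i, k). ?B (\<lambda>j. Y (j, k)) i)"
  define G where "G = (\<lambda>(i, k). ?w (?I i - k) * ?B x i)"
  define P where "P = (\<lambda>(i, k). ?u (?I i - 1 - k) * (- ?p i))"
  define Q where "Q = (\<lambda>(i, k). ?u (?I i - k) * ?q i)"
  have p: "l2 (\<lambda>i. - ?p i)" "l2norm (\<lambda>i. - ?p i) \<le> a * l2norm x"
    using l2_block_diagonal_op[OF d a x] l2norm_block_diagonal_op_le[OF d a x]
      l2_scale[of ?p "-1"] l2norm_scale[of "-1" ?p] by simp_all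
  have q: "l2 ?q" "l2norm ?q \<le> g * l2norm x"
    using l2_block_diagonal_op[OF d g x] l2norm_block_diagonal_op_le[OF d g x] by auto
  have Y: "l2 Y" "l2norm Y = l2norm ?w * l2norm x"
    unfolding Y_def
    using l2_convolution[OF x l2_sine_bump, where h = ?I] l2norm_convolution[OF x l2_sine_bump, where h = ?I] by auto
  have G: "l2 G" "l2norm G = l2norm ?w * l2norm (?B x)"
    unfolding G_def
    using l2_convolution[OF Bx l2_sine_bump, where h = ?I] l2norm_convolution[OF Bx l2_sine_bump, where h = ?I] by auto
  have P: "l2 P" "l2norm P = l2norm ?u * l2norm (\<lambda>i. - ?p i)"
    unfolding P_def
    using l2_convolution[OF p(1) l2_sine_bump_diff, where h = "\<lambda>i. ?I i - 1"]
      l2norm_convolution[OF p(1) l2_sine_bump_diff, where h = "\<lambda>i. ?I i - 1"] by auto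
  have Q: "l2 Q" "l2norm Q = l2norm ?u * l2norm ?q"
    unfolding Q_def
    using l2_convolution[OF q(1) l2_sine_bump_diff, where h = ?I]
      l2norm_convolution[OF q(1) l2_sine_bump_diff, where h = ?I] by auto
  \<comment> \<open>\<open>F\<close> applies the operator after the window and \<open>G\<close> before it; \<open>P\<close> and \<open>Q\<close> collect the
      commutators with the sub- and superdiagonal part.\<close>
  have "F r = G r + (P r + Q r)" for r
  proof (cases r)
    case (Pair i k)
    have 1: "F (i, k) = ?w (?I i + -1 - k) * ?p i + ?w (?I i + 0 - k) * block_diagonal_op d A 0 x i
        + ?w (?I i + 1 - k) * ?q i - z * (?w (?I i - k) * x i)"
      unfolding F_def Y_def shifted_op_def prod.case mat_op_block_tridiagonal[OF d A(2)]
        block_diagonal_op_weight[OF d, of A _ "\<lambda>J. ?w (J - k)"] by simp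
    have 2: "?B x i = ?p i + block_diagonal_op d A 0 x i + ?q i - z * x i"
      unfolding shifted_op_def mat_op_block_tridiagonal[OF d A(2)] by simp
    have "?I i - 1 - k + 1 = ?I i - k" "?I i - k + 1 = ?I i + 1 - k" "?I i + -1 - k = ?I i - 1 - k"
      by simp_all
    then show ?thesis
      unfolding Pair 1 G_def P_def Q_def prod.case 2 by (simp add: algebra_simps)
  qed
  then have F_eq: "F = (\<lambda>r. G r + (P r + Q r))" by blast
  have F: "l2 F" unfolding F_eq by (intro l2_add G P Q)
  have "e * l2norm Y \<le> l2norm F"
  proof (rule l2norm_mono_slices[OF Y(1) F e])
    fix k
    have "(\<lambda>i. Y (i, k)) \<in> block_supported d n k"
    proof -
      have "cmod (Y (i, k)) \<le> l2norm ?w * cmod (x i)" for i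
        using cmod_le_l2norm[OF l2_sine_bump, of n "?I i - k"]
        by (simp add: Y_def norm_mult mult_right_mono)
      then have "l2 (\<lambda>i. Y (i, k))" by (rule l2_dominated[OF x])
      moreover have "?I i \<in> {k + 1..k + int n}" if "Y (i, k) \<noteq> 0" for i
        using that sine_bump_support[of n "?I i - k"] by (auto simp: Y_def)
      ultimately show ?thesis by (simp add: block_supported_def mem_ell2_iff)
    qed
    from lower[OF this] show "e * l2norm (\<lambda>i. Y (i, k)) \<le> l2norm (\<lambda>i. F (i, k))"
      by (simp add: F_def)
  qed
  also have "l2norm F \<le> l2norm G + (l2norm P + l2norm Q)"
    unfolding F_eq using l2norm_triangle[OF G(1) l2_add[OF P(1) Q(1)]] l2norm_triangle[OF P(1) Q(1)]
    by linarith
  also have "\<dots> = l2norm ?w * l2norm (?B x) + l2norm ?u * (l2norm (\<lambda>i. - ?p i) + l2norm ?q)"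
    using G P Q by (simp add: algebra_simps)
  also have "\<dots> \<le> l2norm ?w * l2norm (?B x) + l2norm ?u * (a * l2norm x + g * l2norm x)"
    by (intro add_left_mono mult_left_mono add_mono p q) simp
  also have "\<dots> = l2norm ?w * (l2norm (?B x) + 2 * (a + g) * sin (pi / (2 * (real n + 1))) * l2norm x)"
    unfolding l2norm_sine_bump_diff by (simp add: algebra_simps)
  finally have "l2norm ?w * (e * l2norm x)
      \<le> l2norm ?w * (l2norm (?B x) + 2 * (a + g) * sin (pi / (2 * (real n + 1))) * l2norm x)"
    unfolding Y(2) by (simp add: mult_ac)
  then have "e * l2norm x \<le> l2norm (?B x) + 2 * (a + g) * sin (pi / (2 * (real n + 1))) * l2norm x"
    using l2norm_sine_bump_pos[OF n] by (simp add: mult_le_cancel_left_pos)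
  then show ?thesis by (simp add: left_diff_distrib)
qed

section \<open>Norms of the off-diagonal blocks\<close>

text \<open>The sum of the moduli of the entries shows that the supremum defining the norm is over a bounded
  set; the bound for unit vectors then extends to all vectors by scaling.\<close>

lemma
  fixes N :: "nat \<Rightarrow> nat \<Rightarrow> complex"
  assumes d: "0 < d"
  shows block_norm_nonneg: "0 \<le> block_norm d N"
    and block_norm_bound: "L2_set (\<lambda>r. cmod (\<Sum>s<d. N r s * v s)) {..<d}
           \<le> block_norm d N * L2_set (\<lambda>s. cmod (v s)) {..<d}"
    and block_norm_le_sum_entries: "block_norm d N \<le> (\<Sum>r<d. \<Sum>s<d. cmod (N r s))"
proof -
  let ?N = "\<lambda>v. L2_set (\<lambda>r. cmod (\<Sum>s<d. N r s * v s)) {..<d}"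
  let ?n = "\<lambda>v. L2_set (\<lambda>s. cmod (v s)) {..<d}"
  let ?unit = "{v :: nat \<Rightarrow> complex. ?n v = 1}"
  have entries: "?N v \<le> (\<Sum>r<d. \<Sum>s<d. cmod (N r s))" if "v \<in> ?unit" for v
  proof -
    have v: "cmod (v s) \<le> 1" if "s < d" for s
      using member_le_L2_set[of "{..<d}" s "\<lambda>s. cmod (v s)"] that \<open>v \<in> ?unit\<close> by simp
    have "?N v \<le> (\<Sum>r<d. cmod (\<Sum>s<d. N r s * v s))" by (rule L2_set_le_sum) simp
    also have "\<dots> \<le> (\<Sum>r<d. \<Sum>s<d. cmod (N r s * v s))" by (intro sum_mono norm_sum)
    also have "\<dots> \<le> (\<Sum>r<d. \<Sum>s<d. cmod (N r s))"
      using v by (intro sum_mono) (auto simp: norm_mult intro: mult_left_le)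
    finally show ?thesis .
  qed
  have bdd: "bdd_above (?N ` ?unit)" by (rule bdd_aboveI2[OF entries])
  have unit: "(\<lambda>s. if s = 0 then 1 else 0) \<in> ?unit"
  proof -
    have "(\<Sum>s<d. (cmod (if s = 0 then 1 else 0 :: complex))\<^sup>2) = (\<Sum>s<d. if s = 0 then 1 else 0)"
      by (intro sum.cong) auto
    also have "\<dots> = 1" using d by simp
    finally show ?thesis by (simp add: L2_set_def)
  qed
  have le: "?N v \<le> block_norm d N" if "v \<in> ?unit" for v
    unfolding block_norm_def by (rule cSUP_upper[OF that bdd])
  show nonneg: "0 \<le> block_norm d N" using le[OF unit] L2_set_nonneg order_trans by blast
  show "block_norm d N \<le> (\<Sum>r<d. \<Sum>s<d. cmod (N r s))"
    unfolding block_norm_def using unit by (intro cSUP_least entries) auto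
  show "?N v \<le> block_norm d N * ?n v"
  proof (cases "?n v = 0")
    case True
    then have "\<forall>s<d. v s = 0" by (subst (asm) L2_set_eq_0_iff) auto
    then have "?N v = 0" by (intro L2_set_0') simp
    then show ?thesis using True by simp
  next
    case False
    then have pos: "0 < ?n v" using L2_set_nonneg[of "\<lambda>s. cmod (v s)" "{..<d}"] by linarith
    define u where "u s = complex_of_real (1 / ?n v) * v s" for s
    have "cmod (u s) = 1 / ?n v * cmod (v s)" for s
      using pos by (simp add: u_def norm_divide)
    then have "?n u = 1 / ?n v * ?n v" by (simp only:) (subst L2_set_right_distrib, auto)
    then have u: "u \<in> ?unit" using pos by simp
    have "(\<Sum>s<d. N r s * u s) = complex_of_real (1 / ?n v) * (\<Sum>s<d. N r s * v s)" for r
      unfolding u_def sum_distrib_left by (intro sum.cong refl) (simp only: mult.left_commute)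
    then have "cmod (\<Sum>s<d. N r s * u s) = 1 / ?n v * cmod (\<Sum>s<d. N r s * v s)" for r
      using pos by (simp only: norm_mult norm_of_real) simp
    then have "?N u = 1 / ?n v * ?N v" by (simp only:) (subst L2_set_right_distrib, auto)
    with le[OF u] have "1 / ?n v * ?N v \<le> block_norm d N" by simp
    then show ?thesis using pos by (simp add: divide_le_eq)
  qed
qed

text \<open>With \<open>u = N\<^sup>T v\<close>, one has \<open>\<parallel>u\<parallel>\<^sup>2 = \<Sum>\<^sub>s v\<^sub>s (N (cnj u))\<^sub>s \<le> \<parallel>v\<parallel> \<parallel>N\<parallel> \<parallel>u\<parallel>\<close>. Since blocks of the adjoint
  are transposed blocks of \<open>A\<close>, this bounds its off-diagonals by the norms of \<open>A\<close>.\<close>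

lemma block_norm_transpose_bound:
  fixes N :: "nat \<Rightarrow> nat \<Rightarrow> complex"
  assumes d: "0 < d"
  shows "L2_set (\<lambda>r. cmod (\<Sum>s<d. N s r * v s)) {..<d}
           \<le> block_norm d N * L2_set (\<lambda>s. cmod (v s)) {..<d}"
proof -
  define u where "u r = (\<Sum>s<d. N s r * v s)" for r
  let ?n = "\<lambda>v. L2_set (\<lambda>s. cmod (v s)) {..<d}"
  let ?Ncu = "\<lambda>s. \<Sum>r<d. N s r * cnj (u r)"
  have "complex_of_real ((?n u)\<^sup>2) = (\<Sum>r<d. u r * cnj (u r))"
    by (simp add: L2_set_def sum_nonneg complex_norm_square flip: of_real_power)
  also have "\<dots> = (\<Sum>r<d. \<Sum>s<d. v s * (N s r * cnj (u r)))"
    by (simp add: u_def sum_distrib_right mult_ac)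
  also have "\<dots> = (\<Sum>s<d. v s * ?Ncu s)"
    unfolding sum_distrib_left by (rule sum.swap)
  finally have "(?n u)\<^sup>2 = cmod (\<Sum>s<d. v s * ?Ncu s)"
    by (metis norm_of_real abs_power2 abs_of_nonneg zero_le_power2)
  also have "\<dots> \<le> (\<Sum>s<d. cmod (v s * ?Ncu s))" by (rule norm_sum)
  also have "\<dots> \<le> ?n v * ?n ?Ncu"
    using L2_set_mult_ineq[of "\<lambda>s. cmod (v s)" "\<lambda>s. cmod (?Ncu s)" "{..<d}"] by (simp add: norm_mult)
  also have "\<dots> \<le> ?n v * (block_norm d N * ?n u)"
    using block_norm_bound[OF d, of N "\<lambda>r. cnj (u r)"] by (intro mult_left_mono) auto
  finally have "?n u * ?n u \<le> (block_norm d N * ?n v) * ?n u"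
    by (simp add: power2_eq_square mult_ac)
  then have "?n u \<le> block_norm d N * ?n v"
    using block_norm_nonneg[OF d, of N] by (cases "?n u = 0") (auto simp: mult_le_cancel_right less_le)
  then show ?thesis by (simp add: u_def)
qed

lemma bounded_band_if_band_operator:
  assumes "band_operator A"
  obtains b M where "bounded_band b M A"
proof -
  from assms obtain b :: int where b: "\<And>i j. A i j \<noteq> 0 \<Longrightarrow> \<bar>i - j\<bar> \<le> b"
    and "\<forall>k. \<exists>m. \<forall>i. cmod (A (i + k) i) \<le> m"
    unfolding band_operator_def bounded_iff by auto
  then obtain m where m: "\<And>k i. cmod (A (i + k) i) \<le> m k" by metis
  have m0: "0 \<le> m k" for k using m[of 0 k] norm_ge_zero order_trans by blast
  have "cmod (A i j) \<le> (\<Sum>k\<in>{-b..b}. m k)" for i j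
  proof (cases "A i j = 0")
    case True
    then show ?thesis by (simp add: sum_nonneg m0)
  next
    case False
    then have "i - j \<in> {-b..b}" using b[of i j] by auto
    then have "m (i - j) \<le> (\<Sum>k\<in>{-b..b}. m k)" by (intro member_le_sum) (auto simp: m0)
    then show ?thesis using m[of j "i - j"] by simp
  qed
  with b have "bounded_band b (\<Sum>k\<in>{-b..b}. m k) A" by (simp add: bounded_band_def)
  then show thesis by (rule that)
qed

lemma block_size_pos [simp]: "0 < block_size A"
  by (simp add: block_size_def)

text \<open>Row and column index of a nonzero entry differ by at most the block size, so they lie in the same
  block or in adjacent ones.\<close>

lemma block_tridiagonal_block_size:
  assumes "bounded_band b M A"
  shows "block_tridiagonal (block_size A) A"
  unfolding block_tridiagonal_def
proof (intro allI impI)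
  fix i j assume ij: "A i j \<noteq> 0"
  let ?d = "int (block_size A)"
  have "bdd_above {nat \<bar>i - j\<bar> |i j. A i j \<noteq> 0}"
    using assms by (intro bdd_aboveI[of _ "nat b"]) (auto simp: bounded_band_def intro: nat_mono)
  then have "nat \<bar>i - j\<bar> \<le> bandwidth A"
    unfolding bandwidth_def using ij by (intro cSup_upper) auto
  then have near: "\<bar>i - j\<bar> \<le> ?d" by (auto simp: block_size_def)
  have "i div ?d \<le> (j + ?d) div ?d" "j div ?d \<le> (i + ?d) div ?d"
    using near by (intro zdiv_mono1; simp; linarith)+
  then show "\<bar>i div ?d - j div ?d\<bar> \<le> 1" by simp
qed

lemma block_norm_le_bounded_band:
  assumes "bounded_band b M A" "0 < d"
  shows "block_norm d (block d A I J) \<le> real d * (real d * M)"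
proof -
  have "(\<Sum>r<d. \<Sum>s<d. cmod (block d A I J r s)) \<le> (\<Sum>r<d. \<Sum>s<d. M)"
    using assms(1) by (intro sum_mono) (simp add: block_def bounded_band_def)
  with block_norm_le_sum_entries[OF assms(2), of "block d A I J"] show ?thesis by simp
qed

lemma assumes A: "bounded_band b M A"
  shows block_norm_le_subdiag_norm:
      "block_norm (block_size A) (block (block_size A) A (I + 1) I) \<le> subdiag_norm A"
    and block_norm_le_superdiag_norm:
      "block_norm (block_size A) (block (block_size A) A (I - 1) I) \<le> superdiag_norm A"
  unfolding subdiag_norm_def superdiag_norm_def
  by (intro cSUP_upper bdd_aboveI2[OF block_norm_le_bounded_band[OF A]]; simp)+

lemma assumes A: "bounded_band b M A"
  shows subdiag_norm_nonneg: "0 \<le> subdiag_norm A"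
    and superdiag_norm_nonneg: "0 \<le> superdiag_norm A"
  using block_norm_le_subdiag_norm[OF A] block_norm_le_superdiag_norm[OF A]
    block_norm_nonneg[OF block_size_pos] order_trans by blast+

lemma block_adj: "block d (adj A) I J r s = block d A J I s r"
  by (simp add: block_def adj_def)

text \<open>Transposition turns the superdiagonal of \<open>A\<close> into the subdiagonal of the adjoint. The sum of the
  two norms, and with it the error term, is the same for both operators.\<close>

lemma assumes A: "bounded_band b M A"
  shows subdiag_bounded: "block_diagonal_bounded (block_size A) A (-1) (subdiag_norm A)"
    and superdiag_bounded: "block_diagonal_bounded (block_size A) A 1 (superdiag_norm A)"
    and adj_subdiag_bounded: "block_diagonal_bounded (block_size A) (adj A) (-1) (superdiag_norm A)"
    and adj_superdiag_bounded: "block_diagonal_bounded (block_size A) (adj A) 1 (subdiag_norm A)"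
proof -
  have sub: "block_norm (block_size A) (block (block_size A) A I (I + -1)) \<le> subdiag_norm A"
    and adj_super: "block_norm (block_size A) (block (block_size A) A (I + 1) I) \<le> subdiag_norm A"
    and super: "block_norm (block_size A) (block (block_size A) A I (I + 1)) \<le> superdiag_norm A"
    and adj_sub: "block_norm (block_size A) (block (block_size A) A (I + -1) I) \<le> superdiag_norm A" for I
    using block_norm_le_subdiag_norm[OF A, of "I - 1"] block_norm_le_subdiag_norm[OF A, of I]
      block_norm_le_superdiag_norm[OF A, of "I + 1"] block_norm_le_superdiag_norm[OF A, of I] by simp_all
  note bound = block_norm_bound[OF block_size_pos] block_norm_transpose_bound[OF block_size_pos]
  show "block_diagonal_bounded (block_size A) A (-1) (subdiag_norm A)"
    unfolding block_diagonal_bounded_def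
    by (intro allI order_trans[OF bound(1) mult_right_mono[OF sub]]) simp
  show "block_diagonal_bounded (block_size A) A 1 (superdiag_norm A)"
    unfolding block_diagonal_bounded_def
    by (intro allI order_trans[OF bound(1) mult_right_mono[OF super]]) simp
  show "block_diagonal_bounded (block_size A) (adj A) (-1) (superdiag_norm A)"
    unfolding block_diagonal_bounded_def block_adj
    by (intro allI order_trans[OF bound(2) mult_right_mono[OF adj_sub]]) simp
  show "block_diagonal_bounded (block_size A) (adj A) 1 (subdiag_norm A)"
    unfolding block_diagonal_bounded_def block_adj
    by (intro allI order_trans[OF bound(2) mult_right_mono[OF adj_super]]) simp
qed

section \<open>The pseudospectrum in terms of lower bounds\<close>

text \<open>The matrix of \<open>A - z\<close>, to which the results on band matrices apply.\<close>

definition shift_diagonal :: "(int \<Rightarrow> int \<Rightarrow> complex) \<Rightarrow> complex \<Rightarrow> int \<Rightarrow> int \<Rightarrow> complex" where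
  "shift_diagonal A z i j = A i j - (if i = j then z else 0)"

lemma adj_shift_diagonal: "adj (shift_diagonal A z) = shift_diagonal (adj A) z"
  by (auto simp: adj_def shift_diagonal_def fun_eq_iff)

text \<open>The maximum is needed because the zero matrix has every bandwidth bound, also a negative one.\<close>

lemma bounded_band_shift_diagonal:
  assumes "bounded_band b M A"
  shows "bounded_band (max 0 b) (M + cmod z) (shift_diagonal A z)"
  unfolding bounded_band_def
proof (intro conjI allI impI)
  fix i j
  have M: "cmod (A i j) \<le> M" and b: "A i j \<noteq> 0 \<Longrightarrow> \<bar>i - j\<bar> \<le> b"
    using assms by (simp_all add: bounded_band_def)
  have "cmod (shift_diagonal A z i j) \<le> cmod (A i j) + cmod (if i = j then z else 0)"
    unfolding shift_diagonal_def by (rule norm_triangle_ineq4)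
  also have "\<dots> \<le> M + cmod z" using M by (intro add_mono) auto
  finally show "cmod (shift_diagonal A z i j) \<le> M + cmod z" .
  assume "shift_diagonal A z i j \<noteq> 0"
  then have "A i j \<noteq> 0 \<or> i = j" by (auto simp: shift_diagonal_def split: if_splits)
  then show "\<bar>i - j\<bar> \<le> max 0 b" using b by auto
qed

lemma mat_op_shift_diagonal:
  assumes A: "bounded_band b M A"
  shows "mat_op (shift_diagonal A z) x = shifted_op A z x"
proof
  fix i
  let ?J = "{i - max 0 b..i + max 0 b}"
  have "mat_op (shift_diagonal A z) x i = (\<Sum>j\<in>?J. shift_diagonal A z i j * x j)"
  proof (rule mat_op_finite_sum)
    fix j assume "shift_diagonal A z i j \<noteq> 0"
    then have "\<bar>i - j\<bar> \<le> max 0 b"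
      using bounded_band_shift_diagonal[OF A, of z] unfolding bounded_band_def by blast
    then show "j \<in> ?J" unfolding atLeastAtMost_iff by linarith
  qed simp
  also have "\<dots> = (\<Sum>j\<in>?J. A i j * x j) - (\<Sum>j\<in>?J. if j = i then z * x j else 0)"
    by (subst sum_subtractf[symmetric], intro sum.cong) (auto simp: shift_diagonal_def algebra_simps)
  also have "(\<Sum>j\<in>?J. A i j * x j) = mat_op A x i"
  proof (rule mat_op_finite_sum[symmetric])
    fix j assume "A i j \<noteq> 0"
    then have "\<bar>i - j\<bar> \<le> b" using A unfolding bounded_band_def by blast
    then show "j \<in> ?J" unfolding atLeastAtMost_iff by linarith
  qed simp
  also have "(\<Sum>j\<in>?J. if j = i then z * x j else 0) = z * x i"
    by (subst sum.delta) auto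
  finally show "mat_op (shift_diagonal A z) x i = shifted_op A z x i"
    by (simp add: shifted_op_def)
qed

text \<open>The bound for the adjoint is obtained by solving \<open>A v = cnj x\<close> and using
  \<open>\<parallel>x\<parallel>\<^sup>2 = \<Sum>\<^sub>i x\<^sub>i (A v)\<^sub>i = \<Sum>\<^sub>j (A\<^sup>T x)\<^sub>j v\<^sub>j\<close> with \<open>\<parallel>v\<parallel> \<le> \<parallel>x\<parallel> / e\<close>.\<close>

lemma bounded_below_if_inv_norm_le:
  assumes A: "bounded_band b M A" and e: "0 < e" and inv: "inv_norm (mat_op A) \<le> ereal (1 / e)"
    and x: "l2 x"
  shows "e * l2norm x \<le> l2norm (mat_op A x)" and "e * l2norm x \<le> l2norm (mat_op (adj A) x)"
proof -
  have bij: "bij_betw (mat_op A) ell2 ell2"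
    using inv by (auto simp: inv_norm_def split: if_splits)
  have op: "op_norm (inv_into ell2 (mat_op A)) \<le> ereal (1 / e)"
    using inv bij by (simp add: inv_norm_def)
  have inj: "inj_on (mat_op A) ell2" using bij by (rule bij_betw_imp_inj_on)
  have below: "e * l2norm v \<le> l2norm (mat_op A v)" if v: "l2 v" for v
  proof (cases "l2norm (mat_op A v) = 0")
    case True
    then have "mat_op A v = mat_op A (\<lambda>_. 0)"
      using l2norm_eq_0_iff[OF l2_mat_op[OF A v]] mat_op_scale[OF A, of 0 "\<lambda>_. 0"] by auto
    then have "v = (\<lambda>_. 0)" using inj v by (auto simp: inj_on_def mem_ell2_iff)
    then show ?thesis by simp
  next
    case False
    define r where "r = l2norm (mat_op A v)"
    have r: "0 < r" using False l2norm_nonneg[of "mat_op A v"] unfolding r_def by linarith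
    define u where "u i = complex_of_real (1 / r) * v i" for i
    have u: "l2 u" unfolding u_def by (rule l2_scale[OF v])
    have norm_u: "l2norm u = l2norm v / r"
      unfolding u_def l2norm_scale using r by (simp add: norm_divide)
    have Au: "mat_op A u = (\<lambda>i. complex_of_real (1 / r) * mat_op A v i)"
      unfolding u_def mat_op_scale[OF A] ..
    then have "l2norm (mat_op A u) = 1"
      using r by (simp only: Au l2norm_scale norm_of_real) (simp add: r_def)
    then have "ereal (ell2_norm (inv_into ell2 (mat_op A) (mat_op A u)))
        \<le> op_norm (inv_into ell2 (mat_op A))"
      unfolding op_norm_def using l2_mat_op[OF A u]
      by (intro SUP_upper) (simp add: mem_ell2_iff ell2_norm_eq)
    also have "inv_into ell2 (mat_op A) (mat_op A u) = u"
      using inj u by (simp add: mem_ell2_iff)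
    finally have "l2norm u \<le> 1 / e"
      using op by (metis ell2_norm_eq ereal_less_eq(3) order_trans)
    then have "l2norm v / r \<le> 1 / e" by (simp add: norm_u)
    then show ?thesis using r e by (simp add: r_def field_simps)
  qed
  show "e * l2norm x \<le> l2norm (mat_op A x)" by (rule below[OF x])
  have "(\<lambda>i. cnj (x i)) \<in> mat_op A ` ell2"
    using bij x by (simp add: bij_betw_def mem_ell2_iff)
  then obtain v where v: "l2 v" "mat_op A v = (\<lambda>i. cnj (x i))"
    by (auto simp: mem_ell2_iff)
  have "complex_of_real ((l2norm x)\<^sup>2) = (\<Sum>\<^sub>\<infinity>i. x i * mat_op A v i)"
    unfolding v(2) complex_norm_square[symmetric] using x
    by (intro infsumI[symmetric] has_sum_of_real) (simp add: l2_def l2norm_power2)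
  also have "\<dots> = (\<Sum>\<^sub>\<infinity>j. mat_op (adj A) x j * v j)"
    by (rule mat_op_adj_duality[OF A x v(1)])
  finally have "(l2norm x)\<^sup>2 = cmod (\<Sum>\<^sub>\<infinity>j. mat_op (adj A) x j * v j)"
    by (metis norm_of_real abs_power2)
  also have "\<dots> \<le> l2norm (mat_op (adj A) x) * l2norm v"
    using A x v by (intro l2_Cauchy_Schwarz l2_mat_op) auto
  finally have "e * (l2norm x)\<^sup>2 \<le> l2norm (mat_op (adj A) x) * (e * l2norm v)"
    using e by (simp add: mult.left_commute)
  also have "\<dots> \<le> l2norm (mat_op (adj A) x) * l2norm x"
    using below[OF v(1)] by (intro mult_left_mono) (simp_all add: v(2))
  finally have "(e * l2norm x) * l2norm x \<le> l2norm (mat_op (adj A) x) * l2norm x"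
    by (simp add: power2_eq_square mult.assoc)
  then show "e * l2norm x \<le> l2norm (mat_op (adj A) x)"
    by (cases "l2norm x = 0") (auto simp: mult_le_cancel_right less_le)
qed

text \<open>Injectivity and the bound on the inverse come from the lower bound for \<open>A\<close>, surjectivity from the
  one for its adjoint.\<close>

lemma inv_norm_le_if_bounded_below:
  assumes A: "bounded_band b M A" and e: "0 < e"
    and below: "\<And>x. l2 x \<Longrightarrow> e * l2norm x \<le> l2norm (mat_op A x)"
    and adj_below: "\<And>x. l2 x \<Longrightarrow> e * l2norm x \<le> l2norm (mat_op (adj A) x)"
  shows "inv_norm (mat_op A) \<le> ereal (1 / e)"
proof -
  have inj: "inj_on (mat_op A) ell2"
  proof (rule inj_onI)
    fix x y assume xy: "x \<in> ell2" "y \<in> ell2" "mat_op A x = mat_op A y"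
    have l2: "l2 (\<lambda>i. x i - y i)" using xy by (intro l2_diff) (auto simp: mem_ell2_iff)
    have "mat_op A (\<lambda>i. x i - y i) = (\<lambda>_. 0)" using xy(3) by (simp add: fun_eq_iff mat_op_diff[OF A])
    then have "e * l2norm (\<lambda>i. x i - y i) \<le> 0" using below[OF l2] by simp
    then have "l2norm (\<lambda>i. x i - y i) = 0"
      using e l2norm_nonneg[of "\<lambda>i. x i - y i"] by (simp add: mult_le_0_iff)
    then show "x = y" unfolding l2norm_eq_0_iff[OF l2] by (simp add: fun_eq_iff)
  qed
  have surj: "\<exists>v. l2 v \<and> mat_op A v = y" if "l2 y" for y
    using mat_op_surj_if_adj_bounded_below[OF A e adj_below that] by blast
  have "mat_op A ` ell2 = ell2"
  proof
    show "mat_op A ` ell2 \<subseteq> ell2" using l2_mat_op[OF A] by (auto simp: mem_ell2_iff)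
    show "ell2 \<subseteq> mat_op A ` ell2" using surj unfolding mem_ell2_iff[symmetric] by blast
  qed
  with inj have bij: "bij_betw (mat_op A) ell2 ell2" by (simp add: bij_betw_def)
  have "op_norm (inv_into ell2 (mat_op A)) \<le> ereal (1 / e)"
    unfolding op_norm_def
  proof (rule SUP_least)
    fix y assume "y \<in> {y \<in> ell2. ell2_norm y = 1}"
    then have y: "l2 y" "l2norm y = 1" by (simp_all add: mem_ell2_iff ell2_norm_eq)
    obtain v where v: "l2 v" "mat_op A v = y" using surj y by blast
    then have "inv_into ell2 (mat_op A) y = v" using inj by (auto simp: mem_ell2_iff)
    moreover have "l2norm v \<le> 1 / e" using below[OF v(1)] v(2) y(2) e by (simp add: field_simps)
    ultimately show "ereal (ell2_norm (inv_into ell2 (mat_op A) y)) \<le> ereal (1 / e)"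
      by (simp add: ell2_norm_eq)
  qed
  then show ?thesis using bij by (simp add: inv_norm_def)
qed

lemma pseudospec_iff:
  assumes A: "bounded_band b M A" and e: "0 < e"
  shows "z \<in> pseudospec e A \<longleftrightarrow>
    (\<exists>x. l2 x \<and> (l2norm (shifted_op A z x) < e * l2norm x \<or> l2norm (shifted_op (adj A) z x) < e * l2norm x))"
proof -
  have At: "bounded_band b M (adj A)" using A by simp
  note S = bounded_band_shift_diagonal[OF A, of z]
  have eq: "shifted_op A z = mat_op (shift_diagonal A z)"
    "shifted_op (adj A) z = mat_op (adj (shift_diagonal A z))"
    using mat_op_shift_diagonal[OF A] mat_op_shift_diagonal[OF At]
    by (auto simp: adj_shift_diagonal)
  have "inv_norm (shifted_op A z) \<le> ereal (1 / e) \<longleftrightarrow>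
    (\<forall>x. l2 x \<longrightarrow> e * l2norm x \<le> l2norm (shifted_op A z x) \<and> e * l2norm x \<le> l2norm (shifted_op (adj A) z x))"
    unfolding eq using bounded_below_if_inv_norm_le[OF S e] inv_norm_le_if_bounded_below[OF S e] by blast
  then show ?thesis unfolding pseudospec_def mem_Collect_eq by (metis not_le)
qed

text \<open>Block size and number of blocks are positive so that the infimum in the lower norm is over a
  nonempty set; the unit vector \<open>\<eta>\<close> sits at the first index of block \<open>k + 1\<close>.\<close>

lemma pseudospec_cols_iff:
  assumes A: "bounded_band b M A" and d: "0 < d" and n: "1 \<le> n"
  shows "z \<in> pseudospec_cols d e A n k \<longleftrightarrow>
    (\<exists>x \<in> block_supported d n k. l2norm (shifted_op A z x) < e * l2norm x)"
proof -
  let ?U = "{x \<in> block_supported d n k. ell2_norm x = 1}"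
  define \<eta> :: "int \<Rightarrow> complex" where "\<eta> i = (if i = (k + 1) * int d then 1 else 0)" for i
  have "l2 \<eta>" "(l2norm \<eta>)\<^sup>2 = 1"
    using l2_finite_support[of "{(k + 1) * int d}" \<eta>] l2norm_finite_support[of "{(k + 1) * int d}" \<eta>]
    by (auto simp: \<eta>_def)
  then have "\<eta> \<in> ?U"
    using d n l2norm_nonneg[of \<eta>]
    by (auto simp: block_supported_def mem_ell2_iff ell2_norm_eq \<eta>_def power2_eq_1_iff split: if_splits)
  then have ne: "?U \<noteq> {}" by blast
  have bdd: "bdd_below ((\<lambda>x. ell2_norm (shifted_op A z x)) ` ?U)"
    by (rule bdd_belowI2[of _ 0]) (simp add: ell2_norm_eq)
  have "(\<exists>x\<in>?U. l2norm (shifted_op A z x) < e) \<longleftrightarrow>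
    (\<exists>x \<in> block_supported d n k. l2norm (shifted_op A z x) < e * l2norm x)"
  proof
    assume "\<exists>x \<in> block_supported d n k. l2norm (shifted_op A z x) < e * l2norm x"
    then obtain x where x: "x \<in> block_supported d n k" "l2norm (shifted_op A z x) < e * l2norm x" by blast
    have "l2norm x \<noteq> 0" using x(2) l2norm_nonneg[of "shifted_op A z x"] by (metis mult_zero_right not_less)
    then have r: "0 < l2norm x" using l2norm_nonneg[of x] by linarith
    define c where "c = complex_of_real (1 / l2norm x)"
    have c: "cmod c = 1 / l2norm x" using r by (simp add: c_def norm_divide)
    have "shifted_op A z (\<lambda>i. c * x i) = (\<lambda>i. c * shifted_op A z x i)"
      by (simp add: shifted_op_def mat_op_scale[OF A] algebra_simps)
    then have "l2norm (shifted_op A z (\<lambda>i. c * x i)) = 1 / l2norm x * l2norm (shifted_op A z x)"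
      by (simp add: l2norm_scale c)
    also have "\<dots> < e" using x(2) r by (simp add: divide_less_eq)
    finally have "l2norm (shifted_op A z (\<lambda>i. c * x i)) < e" .
    moreover have "(\<lambda>i. c * x i) \<in> ?U"
      using x(1) r by (auto simp: block_supported_def mem_ell2_iff ell2_norm_eq l2norm_scale c intro: l2_scale)
    ultimately show "\<exists>x\<in>?U. l2norm (shifted_op A z x) < e" by blast
  next
    assume "\<exists>x\<in>?U. l2norm (shifted_op A z x) < e"
    then obtain x where "x \<in> block_supported d n k" "l2norm x = 1" "l2norm (shifted_op A z x) < e"
      by (auto simp: ell2_norm_eq)
    then show "\<exists>x \<in> block_supported d n k. l2norm (shifted_op A z x) < e * l2norm x"
      by (intro bexI[of _ x]) simp_all
  qed
  moreover have "z \<in> pseudospec_cols d e A n k \<longleftrightarrow> (\<exists>x\<in>?U. l2norm (shifted_op A z x) < e)"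
    unfolding pseudospec_cols_def mem_Collect_eq lower_norm_def cINF_less_iff[OF ne bdd]
    by (simp add: ell2_norm_eq)
  ultimately show ?thesis by blast
qed

section \<open>The two inclusions\<close>

theorem proposition5p1:
  fixes A :: "int \<Rightarrow> int \<Rightarrow> complex" and \<epsilon> :: real and n :: nat
  assumes "band_operator A" and "\<epsilon> > 0" and "n \<ge> 1"
  shows "(\<Union>k. pseudospec_cols_pair \<epsilon> A n k) \<subseteq> pseudospec \<epsilon> A
       \<and> pseudospec \<epsilon> A \<subseteq> (\<Union>k. pseudospec_cols_pair (\<epsilon> + eps_n A n) A n k)"
proof -
  let ?d = "block_size A"
  let ?a = "subdiag_norm A" and ?g = "superdiag_norm A"
  obtain b M where A: "bounded_band b M A"
    using bounded_band_if_band_operator[OF assms(1)] by blast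
  then have At: "bounded_band b M (adj A)" by simp
  have pair_iff: "z \<in> pseudospec_cols_pair e A n k \<longleftrightarrow>
      (\<exists>x \<in> block_supported ?d n k. l2norm (shifted_op A z x) < e * l2norm x
         \<or> l2norm (shifted_op (adj A) z x) < e * l2norm x)" for e z k
    unfolding pseudospec_cols_pair_def Un_iff
      pseudospec_cols_iff[OF A block_size_pos assms(3)] pseudospec_cols_iff[OF At block_size_pos assms(3)]
    by blast
  have tri: "block_tridiagonal ?d A" by (rule block_tridiagonal_block_size[OF A])
  then have adj_tri: "block_tridiagonal ?d (adj A)"
    unfolding block_tridiagonal_def adj_def by (metis abs_minus_commute)
  note nonneg = subdiag_norm_nonneg[OF A] superdiag_norm_nonneg[OF A]
  have "0 \<le> sin (pi / (2 * (real n + 1)))"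
    by (intro sin_ge_zero) (auto simp: divide_le_eq)
  with nonneg have e: "0 \<le> \<epsilon> + eps_n A n"
    using assms(2) by (simp add: eps_n_def)
  have "pseudospec \<epsilon> A \<subseteq> (\<Union>k. pseudospec_cols_pair (\<epsilon> + eps_n A n) A n k)"
  proof (rule subsetI, rule ccontr)
    fix z assume z: "z \<in> pseudospec \<epsilon> A" "z \<notin> (\<Union>k. pseudospec_cols_pair (\<epsilon> + eps_n A n) A n k)"
    have lower: "(\<epsilon> + eps_n A n) * l2norm y \<le> l2norm (shifted_op A z y)"
      "(\<epsilon> + eps_n A n) * l2norm y \<le> l2norm (shifted_op (adj A) z y)"
      if "y \<in> block_supported ?d n k" for k y
      using z(2) that unfolding UN_iff pair_iff by (auto simp: not_less)
    have "\<epsilon> * l2norm x \<le> l2norm (shifted_op A z x)" if "l2 x" for x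
      using shifted_op_localization[OF block_size_pos A tri nonneg(1) subdiag_bounded[OF A]
          nonneg(2) superdiag_bounded[OF A] assms(3) e lower(1) that]
      by (simp add: eps_n_def)
    moreover have "\<epsilon> * l2norm x \<le> l2norm (shifted_op (adj A) z x)" if "l2 x" for x
      using shifted_op_localization[OF block_size_pos At adj_tri nonneg(2) adj_subdiag_bounded[OF A]
          nonneg(1) adj_superdiag_bounded[OF A] assms(3) e lower(2) that]
      by (simp add: eps_n_def add.commute)
    ultimately show False
      using z(1) unfolding pseudospec_iff[OF A assms(2)] by (meson not_le)
  qed
  moreover have "(\<Union>k. pseudospec_cols_pair \<epsilon> A n k) \<subseteq> pseudospec \<epsilon> A"
    by (auto simp: pair_iff pseudospec_iff[OF A assms(2)] block_supported_def mem_ell2_iff)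
  ultimately show ?thesis by blast
qed

end
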